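(* Suppose that $1<p<\infty$ and $(X,d,\mu)$ is a doubling metric measure space that supports a $p$-Poincaré inequality for function--upper gradient pairs. Then $\theta_p(X)=1$ and $B^1_{p,p}(X)$ has dimension at most $1$.
   Context: Throughout, $(X,d)$ is a separable metric space with infinitely many points and $\mu$ is a Borel measure on $X$ with $0<\mu(B(x,r))<\infty$ for all $x\in X$, $r>0$, where $B(x,r)=\{y\in X: d(x,y)<r\}$. The space $(X,d,\mu)$ is a doubling metric measure space if there is a constant $C_{\mathrm D}$ such that $0<\mu(B(x,2r))\le C_{\mathrm D}\,\mu(B(x,r))<\infty$ for all $x\in X$, $r>0$. Functions are identified when they agree $\mu$-a.e. For $\theta>0$, $B^\theta_{p,p}(X)$ is the vector space of $u\in L^p(X)$ with $$\|u\|_{B^\theta_{p,p}(X)}^p:=\int_X\int_X\frac{|u(y)-u(x)|^p}{d(x,y)^{\theta p}\,\mu(B(x,d(x,y)))}\,d\mu(y)\,d\mu(x)<\infty$$ (the integrand is taken to be $0$ when $x=y$), and $\theta_p(X):=\sup\{\theta>0: B^\theta_{p,p}(X)\text{ contains non-constant functions}\}$. A Borel function $g:X\to[0,\infty]$ is an upper gradient of $f:X\to[-\infty,\infty]$ if $|f(\gamma(a))-f(\gamma(b))|\le\int_\gamma g\,ds$ for every rectifiable curve $\gamma:[a,b]\to X$ with $a<b$ (interpreted as also requiring $\int_\gamma g\,ds=\infty$ whenever at least one of $f(\gamma(a)),f(\gamma(b))$ is not finite). $(X,d,\mu)$ supports a $p$-Poincaré inequality for function--upper gradient pairs if there are constants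 $C>0$ and $\lambda\ge1$ such that for every measurable function $f$ on $X$ that is integrable on balls, every upper gradient $g$ of $f$ and every ball $B(x,r)$, $$\frac{1}{\mu(B(x,r))}\int_{B(x,r)}|f-f_{B(x,r)}|\,d\mu\le Cr\left(\frac{1}{\mu(B(x,\lambda r))}\int_{B(x,\lambda r)}g^p\,d\mu\right)^{1/p},$$ where $f_{B(x,r)}$ is the mean value of $f$ over $B(x,r)$. *)

theory Defs
  imports "HOL-Analysis.Analysis"
begin

text \<open>
  The metric space \<open>X\<close> is a whole type, of class \<^class>\<open>metric_space\<close> and
  \<^class>\<open>second_countable_topology\<close> (for metric spaces this is separability); balls
  are the open balls \<^const>\<open>ball\<close>.
\<close>

definition borel_finite_balls :: "'a::metric_space measure \<Rightarrow> bool" where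
  "borel_finite_balls M \<longleftrightarrow> sets M = sets borel \<and>
     (\<forall>x r. 0 < r \<longrightarrow> 0 < emeasure M (ball x r) \<and> emeasure M (ball x r) < \<infinity>)"

definition doubling_measure :: "'a::metric_space measure \<Rightarrow> bool" where
  "doubling_measure M \<longleftrightarrow> (\<exists>C::real. \<forall>x r. 0 < r \<longrightarrow>
     0 < emeasure M (ball x (2 * r)) \<and>
     emeasure M (ball x (2 * r)) \<le> ennreal C * emeasure M (ball x r) \<and>
     ennreal C * emeasure M (ball x r) < \<infinity>)"


section \<open>Besov spaces\<close>

text \<open>The double integral is the \<open>p\<close>-th power of the Besov seminorm.\<close>

definition besov_energy :: "'a::metric_space measure \<Rightarrow> real \<Rightarrow> real \<Rightarrow> ('a \<Rightarrow> real) \<Rightarrow> ennreal" where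
  "besov_energy M \<theta> p u =
     (\<integral>\<^sup>+x. (\<integral>\<^sup>+y. (if x = y then 0 else
        ennreal (\<bar>u y - u x\<bar> powr p /
          (dist x y powr (\<theta> * p) * measure M (ball x (dist x y))))) \<partial>M) \<partial>M)"

text \<open>
  A set of functions rather than of a.e. classes; identification of functions that agree
  almost everywhere is built into \<open>ae_constant\<close> and \<open>ae_dim\<close> below.
\<close>

definition Lp_functions :: "'a measure \<Rightarrow> real \<Rightarrow> ('a \<Rightarrow> real) set" where
  "Lp_functions M p =
     {u. u \<in> borel_measurable M \<and> (\<integral>\<^sup>+x. ennreal (\<bar>u x\<bar> powr p) \<partial>M) < \<infinity>}"

definition besov_space :: "'a::metric_space measure \<Rightarrow> real \<Rightarrow> real \<Rightarrow> ('a \<Rightarrow> real) set" where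
  "besov_space M \<theta> p = {u \<in> Lp_functions M p. besov_energy M \<theta> p u < \<infinity>}"

definition ae_constant :: "'a measure \<Rightarrow> ('a \<Rightarrow> real) \<Rightarrow> bool" where
  "ae_constant M u \<longleftrightarrow> (\<exists>c. AE x in M. u x = c)"

text \<open>The supremum is taken in \<^typ>\<open>ereal\<close>, so that it is meaningful also for an unbounded set.\<close>

definition besov_critical :: "'a::metric_space measure \<Rightarrow> real \<Rightarrow> ereal" where
  "besov_critical M p =
     Sup (ereal ` {\<theta>. 0 < \<theta> \<and> (\<exists>u \<in> besov_space M \<theta> p. \<not> ae_constant M u)})"

text \<open>
  Linear independence of the a.e. classes of the members of a finite set of functions. Two
  distinct members that agree almost everywhere make the set dependent, so for an independent
  set \<^const>\<open>card\<close> counts classes.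
\<close>

definition ae_independent :: "'a measure \<Rightarrow> ('a \<Rightarrow> real) set \<Rightarrow> bool" where
  "ae_independent M S \<longleftrightarrow>
     (\<forall>c :: ('a \<Rightarrow> real) \<Rightarrow> real. (AE x in M. (\<Sum>u\<in>S. c u * u x) = 0) \<longrightarrow> (\<forall>u\<in>S. c u = 0))"

text \<open>Dimension, modulo a.e. equality, of a vector space of functions.\<close>

definition ae_dim :: "'a measure \<Rightarrow> ('a \<Rightarrow> real) set \<Rightarrow> enat" where
  "ae_dim M V = Sup {enat (card S) | S. finite S \<and> S \<subseteq> V \<and> ae_independent M S}"


section \<open>Curves and upper gradients\<close>

text \<open>
  A curve is a function on the reals of which only the restriction to \<open>{a..b}\<close> is used.
\<close>

definition curve_length :: "(real \<Rightarrow> 'a::metric_space) \<Rightarrow> real \<Rightarrow> real \<Rightarrow> ennreal" where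
  "curve_length \<gamma> a b =
     Sup {(\<Sum>i<n. ennreal (dist (\<gamma> (t i)) (\<gamma> (t (Suc i))))) | (n::nat) (t :: nat \<Rightarrow> real).
            t 0 = a \<and> t n = b \<and> (\<forall>i<n. t i \<le> t (Suc i))}"

definition rectifiable_curve :: "(real \<Rightarrow> 'a::metric_space) \<Rightarrow> real \<Rightarrow> real \<Rightarrow> bool" where
  "rectifiable_curve \<gamma> a b \<longleftrightarrow> continuous_on {a..b} \<gamma> \<and> curve_length \<gamma> a b < \<infinity>"

text \<open>
  Arc-length parametrization: the choice of \<open>t\<close> is immaterial, since \<open>\<gamma>\<close> is constant between
  two parameters at which the arc length is the same.
\<close>

definition arc_param :: "(real \<Rightarrow> 'a::metric_space) \<Rightarrow> real \<Rightarrow> real \<Rightarrow> real \<Rightarrow> 'a" where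
  "arc_param \<gamma> a b s = \<gamma> (SOME t. t \<in> {a..b} \<and> curve_length \<gamma> a t = ennreal s)"

definition curve_integral ::
    "('a::metric_space \<Rightarrow> ennreal) \<Rightarrow> (real \<Rightarrow> 'a) \<Rightarrow> real \<Rightarrow> real \<Rightarrow> ennreal" where
  "curve_integral g \<gamma> a b =
     (\<integral>\<^sup>+s\<in>{0..enn2real (curve_length \<gamma> a b)}. g (arc_param \<gamma> a b s) \<partial>lborel)"

definition upper_gradient :: "('a::metric_space \<Rightarrow> ennreal) \<Rightarrow> ('a \<Rightarrow> ereal) \<Rightarrow> bool" where
  "upper_gradient g f \<longleftrightarrow> g \<in> borel_measurable borel \<and>
     (\<forall>\<gamma> a b. a < b \<and> rectifiable_curve \<gamma> a b \<longrightarrow>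
        (if \<bar>f (\<gamma> a)\<bar> \<noteq> \<infinity> \<and> \<bar>f (\<gamma> b)\<bar> \<noteq> \<infinity>
         then e2ennreal \<bar>f (\<gamma> a) - f (\<gamma> b)\<bar> \<le> curve_integral g \<gamma> a b
         else curve_integral g \<gamma> a b = \<infinity>))"


section \<open>Poincare inequality\<close>

text \<open>Real powers on \<^typ>\<open>ennreal\<close>; only meant for a positive exponent.\<close>

definition ennreal_powr :: "ennreal \<Rightarrow> real \<Rightarrow> ennreal" where
  "ennreal_powr x q = (if x = \<infinity> then \<infinity> else ennreal (enn2real x powr q))"

definition integrable_on_balls :: "'a::metric_space measure \<Rightarrow> ('a \<Rightarrow> ereal) \<Rightarrow> bool" where
  "integrable_on_balls M f \<longleftrightarrow> f \<in> borel_measurable M \<and>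
     (\<forall>x r. 0 < r \<longrightarrow> (\<integral>\<^sup>+y\<in>ball x r. e2ennreal \<bar>f y\<bar> \<partial>M) < \<infinity>)"

text \<open>
  Functions that are integrable on balls are finite almost everywhere, so that
  \<^const>\<open>real_of_ereal\<close> does not affect the mean value.
\<close>

definition ball_mean :: "'a::metric_space measure \<Rightarrow> ('a \<Rightarrow> ereal) \<Rightarrow> 'a \<Rightarrow> real \<Rightarrow> real" where
  "ball_mean M f x r = (LINT y:ball x r|M. real_of_ereal (f y)) / measure M (ball x r)"

definition poincare_inequality :: "'a::metric_space measure \<Rightarrow> real \<Rightarrow> bool" where
  "poincare_inequality M p \<longleftrightarrow> (\<exists>C>0::real. \<exists>\<Lambda>\<ge>1::real. \<forall>f g x r.
     integrable_on_balls M f \<and> upper_gradient g f \<and> 0 < r \<longrightarrow>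
       (\<integral>\<^sup>+y\<in>ball x r. e2ennreal \<bar>f y - ereal (ball_mean M f x r)\<bar> \<partial>M) / emeasure M (ball x r)
       \<le> ennreal (C * r) *
          ennreal_powr
            ((\<integral>\<^sup>+y\<in>ball x (\<Lambda> * r). ennreal_powr (g y) p \<partial>M) / emeasure M (ball x (\<Lambda> * r)))
            (1 / p))"

end

theory Submission
  imports Defs
begin

text \<open>
  Suppose \<open>\<theta> \<ge> 1\<close> and \<open>u\<close> has finite energy. The part of the double integral over
  \<open>d(x,y) < 3\<epsilon>\<close> tends to \<open>0\<close>, and by Jensen's inequality it controls the \<open>L\<^sup>p\<close> norm of
  \<open>G\<^sub>\<epsilon>(z) = K/\<epsilon>\<close> times the mean of \<open>\<bar>u - u(z)\<bar>\<close> over \<open>B(z,3\<epsilon>)\<close>. Let \<open>u\<^sub>\<epsilon>\<close> be the average of \<open>u\<close>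
  against the kernel \<open>max(0, 2\<epsilon> - d(x,y))\<close>. The doubling property makes \<open>G\<^sub>\<epsilon>(z)\<close> a Lipschitz
  constant of \<open>u\<^sub>\<epsilon>\<close> on all of \<open>B(z,\<epsilon>)\<close>, so \<open>G\<^sub>\<epsilon>\<close> is an upper gradient of \<open>u\<^sub>\<epsilon>\<close>, and also gives
  \<open>\<bar>u\<^sub>\<epsilon> - u\<bar> \<le> \<epsilon> G\<^sub>\<epsilon>\<close>. As \<open>\<epsilon> \<rightarrow> 0\<close>, the Poincare inequality for \<open>(u\<^sub>\<epsilon>, G\<^sub>\<epsilon>)\<close> forces \<open>u\<close> to be
  constant on every ball.

  Suppose \<open>0 < \<theta> < 1\<close>. Cones \<open>max(0, R - d(x\<^sub>0,y))\<close> have finite energy, by a sum over dyadic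
  annuli in which the near annuli contribute a geometric series of ratio \<open>2 powr ((\<theta> - 1) * p)\<close> and
  the far ones a geometric series of ratio \<open>2 powr (-\<theta> * p)\<close>.
\<close>

section \<open>Arc length and upper gradients\<close>

definition partition_seq :: "(nat \<Rightarrow> real) \<Rightarrow> nat \<Rightarrow> real \<Rightarrow> real \<Rightarrow> bool" where
  "partition_seq t n a b \<longleftrightarrow> t 0 = a \<and> t n = b \<and> (\<forall>i<n. t i \<le> t (Suc i))"

text \<open>The sum is kept real, whereas \<open>curve_length\<close> adds in
  \<open>ennreal\<close>, so that triangle inequalities can be used in real arithmetic.\<close>

definition polygon_length :: "(real \<Rightarrow> 'a::metric_space) \<Rightarrow> (nat \<Rightarrow> real) \<Rightarrow> nat \<Rightarrow> real" where
  "polygon_length \<gamma> t n = (\<Sum>i<n. dist (\<gamma> (t i)) (\<gamma> (t (Suc i))))"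

lemma polygon_length_0 [simp]: "polygon_length \<gamma> t 0 = 0"
  by (simp add: polygon_length_def)

lemma polygon_length_Suc [simp]:
  "polygon_length \<gamma> t (Suc n) = polygon_length \<gamma> t n + dist (\<gamma> (t n)) (\<gamma> (t (Suc n)))"
  by (simp add: polygon_length_def)

lemma polygon_length_nonneg [simp]: "0 \<le> polygon_length \<gamma> t n"
  by (simp add: polygon_length_def sum_nonneg)

lemma curve_length_eq:
  "curve_length \<gamma> a b = Sup {ennreal (polygon_length \<gamma> t n) | n t. partition_seq t n a b}"
  unfolding curve_length_def partition_seq_def polygon_length_def by (simp add: sum_ennreal)

lemma partition_seq_mono:
  assumes "partition_seq t n a b" "i \<le> j" "j \<le> n"
  shows "t i \<le> t j"
  using assms(2,3)
proof (induction j rule: dec_induct)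
  case (step k)
  then show ?case using assms(1) unfolding partition_seq_def by (meson Suc_le_eq less_imp_le order_trans)
qed simp

lemma partition_seq_le: "partition_seq t n a b \<Longrightarrow> a \<le> b"
  using partition_seq_mono[of t n a b 0 n] by (simp add: partition_seq_def)

lemma partition_seq_SucD: "partition_seq t (Suc n) a b \<Longrightarrow> partition_seq t n a (t n) \<and> t n \<le> b \<and> t (Suc n) = b"
  by (auto simp: partition_seq_def)

lemma polygon_length_le_curve_length:
  "partition_seq t n a b \<Longrightarrow> ennreal (polygon_length \<gamma> t n) \<le> curve_length \<gamma> a b"
  unfolding curve_length_eq by (rule Sup_upper) blast

lemma curve_length_leI:
  "(\<And>n t. partition_seq t n a b \<Longrightarrow> ennreal (polygon_length \<gamma> t n) \<le> K) \<Longrightarrow> curve_length \<gamma> a b \<le> K"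
  unfolding curve_length_eq by (rule Sup_least) blast

text \<open>A constant can be moved inside a supremum over a non-empty set. Here
  \<open>a \<le> b\<close> provides the two-point partition, which yields \<open>c \<le> K\<close>
  and so makes the truncated subtraction \<open>K - c\<close> exact.\<close>

lemma curve_length_add_leI:
  assumes "a \<le> b"
    and *: "\<And>n t. partition_seq t n a b \<Longrightarrow> ennreal (polygon_length \<gamma> t n) + c \<le> K"
  shows "curve_length \<gamma> a b + c \<le> K"
proof (cases "K = top")
  case False
  have "partition_seq (\<lambda>i. if i = 0 then a else b) 1 a b"
    using assms(1) by (simp add: partition_seq_def)
  from *[OF this] have "c \<le> K"
    by (metis add.commute le_iff_add order_trans)
  have "curve_length \<gamma> a b \<le> K - c"
  proof (rule curve_length_leI)
    fix n t assume "partition_seq t n a b"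
    from *[OF this] \<open>c \<le> K\<close> False show "ennreal (polygon_length \<gamma> t n) \<le> K - c"
      by (auto simp: ennreal_le_minus_iff add.commute top_unique)
  qed
  then have "curve_length \<gamma> a b + c \<le> (K - c) + c" by (rule add_right_mono)
  also have "\<dots> = K" using \<open>c \<le> K\<close> by (rule diff_add_cancel_ennreal)
  finally show ?thesis .
qed simp

lemma polygon_length_append:
  assumes "partition_seq t n a c" "c \<le> d"
  shows "ennreal (polygon_length \<gamma> t n) + ennreal (dist (\<gamma> c) (\<gamma> d)) \<le> curve_length \<gamma> a d"
proof -
  define s where "s = t(Suc n := d)"
  have *: "s i = t i" if "i \<le> n" for i using that by (simp add: s_def)
  have "partition_seq s (Suc n) a d"
    using assms unfolding partition_seq_def by (auto simp: s_def less_Suc_eq)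
  moreover have "polygon_length \<gamma> s (Suc n) = polygon_length \<gamma> t n + dist (\<gamma> c) (\<gamma> d)"
  proof -
    have "polygon_length \<gamma> s n = polygon_length \<gamma> t n"
      unfolding polygon_length_def by (rule sum.cong) (auto simp: *)
    then show ?thesis using assms by (simp add: s_def partition_seq_def)
  qed
  ultimately show ?thesis
    by (metis polygon_length_le_curve_length ennreal_plus polygon_length_nonneg zero_le_dist)
qed

lemma curve_length_self: "curve_length \<gamma> a a = 0"
proof -
  have "polygon_length \<gamma> t n = 0" if p: "partition_seq t n a a" for n t
  proof -
    have "t i = a" if "i \<le> n" for i
      using partition_seq_mono[OF p, of 0 i] partition_seq_mono[OF p, of i n] p that
      by (auto simp: partition_seq_def)
    then show ?thesis unfolding polygon_length_def by (intro sum.neutral) auto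
  qed
  then show ?thesis by (intro antisym curve_length_leI) auto
qed

lemma curve_length_append:
  assumes "a \<le> c" "c \<le> d"
  shows "curve_length \<gamma> a c + ennreal (dist (\<gamma> c) (\<gamma> d)) \<le> curve_length \<gamma> a d"
  by (rule curve_length_add_leI) (use assms polygon_length_append in auto)

lemma curve_length_mono: "a \<le> c \<Longrightarrow> c \<le> d \<Longrightarrow> curve_length \<gamma> a c \<le> curve_length \<gamma> a d"
  using curve_length_append[of a c d \<gamma>] by (meson le_iff_add order_trans)

text \<open>Walking along a partition of the second interval, each segment is absorbed by
  \<open>curve_length_append\<close>, so the length up to the current point grows at least as fast
  as the polygon.\<close>

lemma curve_length_concat:
  assumes "a \<le> c" "c \<le> b"
  shows "curve_length \<gamma> a c + curve_length \<gamma> c b \<le> curve_length \<gamma> a b"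
proof -
  have *: "ennreal (polygon_length \<gamma> t n) + curve_length \<gamma> a c \<le> curve_length \<gamma> a d"
    if "partition_seq t n c d" for n t d
    using that
  proof (induction n arbitrary: d)
    case 0
    then show ?case by (auto simp: partition_seq_def)
  next
    case (Suc n)
    note p = partition_seq_SucD[OF Suc.prems]
    have "a \<le> t n" using p partition_seq_le[of t n c] assms by force
    have "ennreal (polygon_length \<gamma> t (Suc n)) + curve_length \<gamma> a c
      = (ennreal (polygon_length \<gamma> t n) + curve_length \<gamma> a c) + ennreal (dist (\<gamma> (t n)) (\<gamma> d))"
      using p by (simp add: ac_simps flip: ennreal_plus)
    also have "\<dots> \<le> curve_length \<gamma> a (t n) + ennreal (dist (\<gamma> (t n)) (\<gamma> d))"
      using Suc.IH p by (intro add_right_mono) auto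
    also have "\<dots> \<le> curve_length \<gamma> a d"
      using p \<open>a \<le> t n\<close> by (intro curve_length_append) auto
    finally show ?case .
  qed
  show ?thesis
    using curve_length_add_leI[OF assms(2) *] by (simp add: add.commute)
qed

text \<open>No partition point lies strictly between \<open>c\<close> and \<open>d\<close>, so a
  single segment bridges this gap, and it is split at \<open>c\<close> and \<open>d\<close> by the
  triangle inequality. This bounds the length from above near \<open>[c, d]\<close> in terms of the
  chord.\<close>

lemma polygon_length_split:
  assumes "partition_seq t n a b" "a \<le> c" "c \<le> d" "d \<le> b"
    and "\<And>i. i \<le> n \<Longrightarrow> t i \<le> c \<or> d \<le> t i"
  shows "ennreal (polygon_length \<gamma> t n)
    \<le> curve_length \<gamma> a c + ennreal (dist (\<gamma> c) (\<gamma> d)) + curve_length \<gamma> d b"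
  using assms
proof (induction n arbitrary: b)
  case (Suc n)
  note p = partition_seq_SucD[OF Suc.prems(1)]
  have 1: "ennreal (polygon_length \<gamma> t (Suc n))
      = ennreal (polygon_length \<gamma> t n) + ennreal (dist (\<gamma> (t n)) (\<gamma> b))"
    using p by (simp add: ac_simps flip: ennreal_plus)
  show ?case
  proof (cases "d \<le> t n")
    case True
    have "ennreal (polygon_length \<gamma> t n)
        \<le> curve_length \<gamma> a c + ennreal (dist (\<gamma> c) (\<gamma> d)) + curve_length \<gamma> d (t n)"
      using Suc.IH[of "t n"] Suc.prems p True by auto
    then have "ennreal (polygon_length \<gamma> t (Suc n))
        \<le> curve_length \<gamma> a c + ennreal (dist (\<gamma> c) (\<gamma> d)) + (curve_length \<gamma> d (t n) + ennreal (dist (\<gamma> (t n)) (\<gamma> b)))"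
      unfolding 1 add.assoc[symmetric] by (rule add_right_mono)
    also have "\<dots> \<le> curve_length \<gamma> a c + ennreal (dist (\<gamma> c) (\<gamma> d)) + curve_length \<gamma> d b"
      using curve_length_append[OF True, of b] p by (intro add_left_mono) auto
    finally show ?thesis .
  next
    case False
    \<comment> \<open>The last segment is the bridging one: it starts at or before \<open>c\<close>
      and ends at \<open>b\<close>, which is at or after \<open>d\<close>.\<close>
    then have "t n \<le> c" using Suc.prems(5)[of n] by auto
    have "dist (\<gamma> (t n)) (\<gamma> b) \<le> dist (\<gamma> (t n)) (\<gamma> c) + dist (\<gamma> c) (\<gamma> d) + dist (\<gamma> d) (\<gamma> b)"
      by (metis add.assoc add_left_mono dist_triangle order_trans)
    then have "ennreal (polygon_length \<gamma> t (Suc n))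
        \<le> ennreal (polygon_length \<gamma> t n + dist (\<gamma> (t n)) (\<gamma> c) + dist (\<gamma> c) (\<gamma> d) + dist (\<gamma> d) (\<gamma> b))"
      using p by (intro ennreal_leI) auto
    also have "\<dots> = (ennreal (polygon_length \<gamma> t n) + ennreal (dist (\<gamma> (t n)) (\<gamma> c)))
        + ennreal (dist (\<gamma> c) (\<gamma> d)) + ennreal (dist (\<gamma> d) (\<gamma> b))"
      by (simp add: ac_simps flip: ennreal_plus)
    also have "\<dots> \<le> curve_length \<gamma> a c + ennreal (dist (\<gamma> c) (\<gamma> d)) + curve_length \<gamma> d b"
      using polygon_length_append[of t n a "t n" c \<gamma>] p \<open>t n \<le> c\<close>
        curve_length_append[of d d b \<gamma>] Suc.prems
      by (intro add_mono) (auto simp: curve_length_self)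
    finally show ?thesis .
  qed
qed (auto simp: partition_seq_def)

text \<open>
  \<open>F\<close> is the set of points of a partition whose polygon length is within \<open>\<delta>\<close> of the arc length.
\<close>

lemma curve_length_local_bound:
  assumes fin: "curve_length \<gamma> a b < \<infinity>" and "0 < \<delta>"
  obtains F where "finite F"
    "\<And>c d. \<lbrakk>a \<le> c; c \<le> d; d \<le> b; \<And>t. t \<in> F \<Longrightarrow> t \<le> c \<or> d \<le> t\<rbrakk> \<Longrightarrow>
      curve_length \<gamma> a d \<le> curve_length \<gamma> a c + ennreal (dist (\<gamma> c) (\<gamma> d)) + ennreal \<delta>"
proof (cases "a \<le> b")
  case False
  then show thesis using that[of "{}"] by force
next
  case True
  have "\<exists>n t. partition_seq t n a b \<and> curve_length \<gamma> a b \<le> ennreal (polygon_length \<gamma> t n) + ennreal \<delta>"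
  proof (rule ccontr)
    \<comment> \<open>If every polygon fell short by more than \<open>\<delta>\<close>, the finite
      length plus \<open>\<delta>\<close> would be at most the length.\<close>
    assume "\<not> ?thesis"
    then have "curve_length \<gamma> a b + ennreal \<delta> \<le> curve_length \<gamma> a b"
      by (intro curve_length_add_leI[OF True]) (auto simp: not_le intro: less_imp_le)
    then show False using fin \<open>0 < \<delta>\<close>
      by (cases "curve_length \<gamma> a b") (auto simp flip: ennreal_plus)
  qed
  then obtain n t where p: "partition_seq t n a b"
    and le: "curve_length \<gamma> a b \<le> ennreal (polygon_length \<gamma> t n) + ennreal \<delta>" by blast
  show thesis
  proof (rule that[of "t ` {..n}"])
    fix c d assume cd: "a \<le> c" "c \<le> d" "d \<le> b"
      and F: "\<And>s. s \<in> t ` {..n} \<Longrightarrow> s \<le> c \<or> d \<le> s"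
    have "curve_length \<gamma> a d + curve_length \<gamma> d b \<le> curve_length \<gamma> a b"
      using cd by (intro curve_length_concat) auto
    also note le
    also have "ennreal (polygon_length \<gamma> t n)
      \<le> curve_length \<gamma> a c + ennreal (dist (\<gamma> c) (\<gamma> d)) + curve_length \<gamma> d b"
      by (rule polygon_length_split[OF p]) (use cd F in auto)
    \<comment> \<open>The length over \<open>[d, b]\<close> occurs on both sides and can be
      cancelled because it is finite.\<close>
    finally have *: "curve_length \<gamma> d b + curve_length \<gamma> a d
        \<le> curve_length \<gamma> d b + (curve_length \<gamma> a c + ennreal (dist (\<gamma> c) (\<gamma> d)) + ennreal \<delta>)"
      by (simp add: ac_simps)
    have "curve_length \<gamma> a d + curve_length \<gamma> d b < \<infinity>"
      using \<open>curve_length \<gamma> a d + curve_length \<gamma> d b \<le> curve_length \<gamma> a b\<close> fin by (rule le_less_trans)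
    then have "curve_length \<gamma> d b \<noteq> top" by auto
    with * show "curve_length \<gamma> a d \<le> curve_length \<gamma> a c + ennreal (dist (\<gamma> c) (\<gamma> d)) + ennreal \<delta>"
      by (simp add: ennreal_add_left_cancel_le)
  qed simp
qed

section \<open>The arc-length function and curve integrals\<close>

text \<open>Continuity is the substantial claim. On an interval that avoids the finite set
  \<open>F\<close> in its interior, the length increases by at most the chord plus
  \<open>e/2\<close>, and the chord is small because \<open>\<gamma>\<close> is continuous.\<close>

lemma rectifiable_arc_length:
  assumes "rectifiable_curve \<gamma> a b" "a \<le> b"
  defines "len \<equiv> \<lambda>t. enn2real (curve_length \<gamma> a t)"
  shows "\<And>t. t \<in> {a..b} \<Longrightarrow> curve_length \<gamma> a t = ennreal (len t)"
    and "len a = 0"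
    and "\<And>c d. a \<le> c \<Longrightarrow> c \<le> d \<Longrightarrow> d \<le> b \<Longrightarrow> dist (\<gamma> c) (\<gamma> d) \<le> len d - len c"
    and "continuous_on {a..b} len"
proof -
  have fin: "curve_length \<gamma> a b < \<infinity>" and cont: "continuous_on {a..b} \<gamma>"
    using assms by (auto simp: rectifiable_curve_def)
  show len: "curve_length \<gamma> a t = ennreal (len t)" if "t \<in> {a..b}" for t
    using le_less_trans[OF curve_length_mono[of a t b \<gamma>] fin] that by (simp add: len_def)
  have nn: "0 \<le> len t" for t by (simp add: len_def)
  show "len a = 0" by (simp add: len_def curve_length_self)
  show step: "dist (\<gamma> c) (\<gamma> d) \<le> len d - len c" if "a \<le> c" "c \<le> d" "d \<le> b" for c d
    using curve_length_append[OF that(1,2), of \<gamma>] len[of c] len[of d] that nn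
    by (simp flip: ennreal_plus)
  show "continuous_on {a..b} len"
    unfolding continuous_on_iff
  proof (intro ballI allI impI)
    fix s and e :: real assume s: "s \<in> {a..b}" and "0 < e"
    obtain F where F: "finite F"
      "\<And>c d. \<lbrakk>a \<le> c; c \<le> d; d \<le> b; \<And>t. t \<in> F \<Longrightarrow> t \<le> c \<or> d \<le> t\<rbrakk> \<Longrightarrow>
        curve_length \<gamma> a d \<le> curve_length \<gamma> a c + ennreal (dist (\<gamma> c) (\<gamma> d)) + ennreal (e/2)"
      using curve_length_local_bound[OF fin, of "e/2"] \<open>0 < e\<close> by auto
    \<comment> \<open>The point \<open>s\<close> may itself belong to \<open>F\<close>; this is
      harmless, since \<open>s\<close> is always an end point of the interval considered.\<close>
    obtain r where r: "0 < r" "\<And>t. t \<in> F \<Longrightarrow> t \<noteq> s \<Longrightarrow> r \<le> dist s t"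
      using finite_set_avoid[OF F(1)] by metis
    obtain r' where r': "0 < r'" "\<And>t. t \<in> {a..b} \<Longrightarrow> dist t s < r' \<Longrightarrow> dist (\<gamma> t) (\<gamma> s) < e/2"
      using cont s \<open>0 < e\<close> unfolding continuous_on_iff by (metis half_gt_zero)
    have *: "len d \<le> len c + dist (\<gamma> c) (\<gamma> d) + e/2"
      if "a \<le> c" "c \<le> d" "d \<le> b" "\<And>t. t \<in> F \<Longrightarrow> t \<le> c \<or> d \<le> t" for c d
      using F(2)[OF that] len[of c] len[of d] that(1-3) nn \<open>0 < e\<close> by (simp flip: ennreal_plus)
    show "\<exists>\<delta>>0. \<forall>t\<in>{a..b}. dist t s < \<delta> \<longrightarrow> dist (len t) (len s) < e"
    proof (intro exI[of _ "min r r'"] conjI ballI impI)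
      fix t assume t: "t \<in> {a..b}" "dist t s < min r r'"
      then have d: "dist (\<gamma> t) (\<gamma> s) < e/2" using r' by auto
      show "dist (len t) (len s) < e"
      proof (cases "t \<le> s")
        case True
        have "len s \<le> len t + dist (\<gamma> t) (\<gamma> s) + e/2"
          using True t s r(2) by (intro *) (force simp: dist_real_def)+
        moreover have "len t \<le> len s" using step[of t s] True t s by (smt (verit) atLeastAtMost_iff zero_le_dist)
        ultimately show ?thesis using d by (simp add: dist_real_def)
      next
        case False
        have "len t \<le> len s + dist (\<gamma> s) (\<gamma> t) + e/2"
          using False t s r(2) by (intro *) (force simp: dist_real_def)+
        moreover have "len s \<le> len t" using step[of s t] False t s by (smt (verit) atLeastAtMost_iff zero_le_dist)
        ultimately show ?thesis using d by (simp add: dist_real_def dist_commute)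
      qed
    qed (use r r' in auto)
  qed
qed

text \<open>
  The arc length is cut into pieces shorter than \<open>e\<close>; on each of them every point of the curve is a
  possible centre \<open>z\<close> for both end points. The integrand is bounded below by a step function, so
  that its measurability plays no role.
\<close>

lemma curve_integral_ge:
  fixes f :: "'a::metric_space \<Rightarrow> real" and g :: "'a \<Rightarrow> real"
  assumes "rectifiable_curve \<gamma> a b" "a \<le> b" "0 < e" and g: "\<And>z. 0 \<le> g z"
    and fg: "\<And>x y z. dist x z < e \<Longrightarrow> dist y z < e \<Longrightarrow> \<bar>f x - f y\<bar> \<le> dist x y * g z"
  shows "ennreal \<bar>f (\<gamma> a) - f (\<gamma> b)\<bar> \<le> curve_integral (\<lambda>z. ennreal (g z)) \<gamma> a b"
proof -
  define len where "len t = enn2real (curve_length \<gamma> a t)" for t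
  note arc = rectifiable_arc_length[OF assms(1,2), folded len_def]
  define L where "L = len b"
  have L: "0 \<le> L" by (simp add: L_def len_def)
  show ?thesis
  proof (cases "L = 0")
    case True
    then have "\<gamma> a = \<gamma> b" using arc(3)[of a b] arc(2) assms(2) by (simp add: L_def len_def)
    then show ?thesis by simp
  next
    case False
    with L have "0 < L" by simp
    have ivt: "\<exists>t\<in>{a..b}. len t = s" if "0 \<le> s" "s \<le> L" for s
      using IVT'[of len a s b] that arc assms(2) by (auto simp: L_def)
    have dle: "dist (\<gamma> c) (\<gamma> d) \<le> \<bar>len d - len c\<bar>" if "c \<in> {a..b}" "d \<in> {a..b}" for c d
      using arc(3)[of c d] arc(3)[of d c] that by (cases "c \<le> d") (auto simp: dist_commute)
    obtain N :: nat where N: "0 < N" "L / N < e"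
      using reals_Archimedean2[of "L / e"] \<open>0 < L\<close> \<open>0 < e\<close>
      by (metis divide_less_eq divide_pos_pos mult.commute less_trans of_nat_0_less_iff)
    define h where "h = L / N"
    have h: "0 < h" "h < e" "N * h = L" using N \<open>0 < L\<close> by (auto simp: h_def)
    have ih: "real i * h \<le> L" if "i \<le> N" for i
      using that h by (metis mult_right_mono of_nat_le_iff less_imp_le)
    \<comment> \<open>The two end values are set by hand: \<open>SOME\<close> could return another
      parameter of arc length 0 or \<open>L\<close>, and the telescoping sum must run from
      \<open>a\<close> to \<open>b\<close>.\<close>
    define \<tau> where "\<tau> = (\<lambda>i. if i = 0 then a else if i = N then b else SOME t. t \<in> {a..b} \<and> len t = real i * h)"
    have \<tau>: "\<tau> i \<in> {a..b} \<and> len (\<tau> i) = real i * h" if "i \<le> N" for i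
    proof -
      have "\<exists>t. t \<in> {a..b} \<and> len t = real i * h" using ivt[OF _ ih[OF that]] h by auto
      from someI_ex[OF this] show ?thesis
        using assms(2) arc(2) h by (auto simp: \<tau>_def L_def)
    qed
    have \<tau>0: "\<tau> 0 = a" "\<tau> N = b" using N by (auto simp: \<tau>_def)
    define \<Delta> where "\<Delta> = (\<lambda>i. \<bar>f (\<gamma> (\<tau> i)) - f (\<gamma> (\<tau> (Suc i)))\<bar> / h)"
    have \<Delta>0: "0 \<le> \<Delta> i" for i using h by (simp add: \<Delta>_def)
    \<comment> \<open>Half-open pieces are disjoint, so at each \<open>s\<close> at most one term of
      the step function is non-zero.\<close>
    define J where "J = (\<lambda>i. {real i * h..<real (Suc i) * h})"
    have key: "\<Delta> i \<le> g (arc_param \<gamma> a b s)" if "i < N" "s \<in> J i" for i s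
    proof -
      have s: "0 \<le> s" "s \<le> L" using that ih[of "Suc i"] order_trans[OF mult_nonneg_nonneg[of "real i" h]] h
        by (auto simp: J_def)
      have "\<exists>t. t \<in> {a..b} \<and> curve_length \<gamma> a t = ennreal s"
        using ivt[OF s] arc(1) by auto
      from someI_ex[OF this] obtain t where t: "t \<in> {a..b}" "curve_length \<gamma> a t = ennreal s"
        and ap: "arc_param \<gamma> a b s = \<gamma> t"
        unfolding arc_param_def by blast
      have ts: "len t = s" using t s by (simp add: len_def)
      have i: "\<tau> i \<in> {a..b}" "len (\<tau> i) = real i * h" "\<tau> (Suc i) \<in> {a..b}" "len (\<tau> (Suc i)) = real (Suc i) * h"
        using \<tau>[of i] \<tau>[of "Suc i"] that by auto
      have "dist (\<gamma> (\<tau> i)) (\<gamma> t) < e" "dist (\<gamma> (\<tau> (Suc i))) (\<gamma> t) < e"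
        using dle[of "\<tau> i" t] dle[of "\<tau> (Suc i)" t] i t(1) ts that(2) h
        by (auto simp: J_def algebra_simps)
      then have "\<bar>f (\<gamma> (\<tau> i)) - f (\<gamma> (\<tau> (Suc i)))\<bar> \<le> dist (\<gamma> (\<tau> i)) (\<gamma> (\<tau> (Suc i))) * g (\<gamma> t)"
        by (rule fg)
      also have "\<dots> \<le> h * g (\<gamma> t)"
        using dle[of "\<tau> i" "\<tau> (Suc i)"] i g h by (intro mult_right_mono) (auto simp: algebra_simps)
      finally show ?thesis using h by (simp add: \<Delta>_def ap field_simps)
    qed
    have "\<bar>f (\<gamma> a) - f (\<gamma> b)\<bar> = \<bar>\<Sum>i<N. f (\<gamma> (\<tau> i)) - f (\<gamma> (\<tau> (Suc i)))\<bar>"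
      using sum_lessThan_telescope'[of "\<lambda>i. f (\<gamma> (\<tau> i))" N] by (simp add: \<tau>0)
    also have "\<dots> \<le> (\<Sum>i<N. h * \<Delta> i)"
      using h by (intro order_trans[OF sum_abs]) (simp add: \<Delta>_def)
    finally have "ennreal \<bar>f (\<gamma> a) - f (\<gamma> b)\<bar> \<le> ennreal (\<Sum>i<N. h * \<Delta> i)"
      by (rule ennreal_leI)
    also have "\<dots> = (\<Sum>i<N. ennreal (\<Delta> i) * emeasure lborel (J i))"
      using h \<Delta>0 by (subst sum_ennreal[symmetric])
        (auto simp: J_def algebra_simps ennreal_mult[symmetric] intro!: sum.cong)
    also have "\<dots> = (\<integral>\<^sup>+s. (\<Sum>i<N. ennreal (\<Delta> i) * indicator (J i) s) \<partial>lborel)"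
      by (subst nn_integral_sum) (auto simp: J_def nn_integral_cmult_indicator)
    also have "\<dots> \<le> (\<integral>\<^sup>+s\<in>{0..L}. ennreal (g (arc_param \<gamma> a b s)) \<partial>lborel)"
    proof (rule nn_integral_mono)
      fix s
      have uniq: "i = j" if "s \<in> J i" "s \<in> J j" for i j
      proof -
        have "real i * h < real (Suc j) * h" "real j * h < real (Suc i) * h"
          using that by (auto simp: J_def simp del: of_nat_Suc intro: le_less_trans)
        then have "real i < real (Suc j)" "real j < real (Suc i)"
          using h by (simp_all del: of_nat_Suc)
        then show ?thesis by linarith
      qed
      show "(\<Sum>i<N. ennreal (\<Delta> i) * indicator (J i) s)
        \<le> ennreal (g (arc_param \<gamma> a b s)) * indicator {0..L} s"
      proof (cases "\<exists>i<N. s \<in> J i")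
        case True
        then obtain i where i: "i < N" "s \<in> J i" by blast
        have "(\<Sum>j<N. ennreal (\<Delta> j) * indicator (J j) s) = (\<Sum>j\<in>{i}. ennreal (\<Delta> j) * indicator (J j) s)"
          by (rule sum.mono_neutral_right) (use i uniq in \<open>auto simp: indicator_def\<close>)
        also have "\<dots> \<le> ennreal (g (arc_param \<gamma> a b s))" using key[OF i] i by (simp add: ennreal_leI)
        also have "\<dots> = ennreal (g (arc_param \<gamma> a b s)) * indicator {0..L} s"
          using i ih[of "Suc i"] order_trans[OF mult_nonneg_nonneg[of "real i" h]] h
          by (auto simp: J_def indicator_def)
        finally show ?thesis by simp
      next
        case False
        then have "(\<Sum>i<N. ennreal (\<Delta> i) * indicator (J i) s) = 0" by (intro sum.neutral) auto
        then show ?thesis by simp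
      qed
    qed
    finally show ?thesis by (simp add: curve_integral_def L_def len_def)
  qed
qed

text \<open>The radius \<open>e\<close> is the same at all points, so every rectifiable curve can be
  cut into finitely many pieces of arc length below \<open>e\<close>.\<close>

lemma upper_gradientI_local:
  fixes f :: "'a::metric_space \<Rightarrow> real" and g :: "'a \<Rightarrow> real"
  assumes "g \<in> borel_measurable borel" "0 < e" "\<And>z. 0 \<le> g z"
    "\<And>x y z. dist x z < e \<Longrightarrow> dist y z < e \<Longrightarrow> \<bar>f x - f y\<bar> \<le> dist x y * g z"
  shows "upper_gradient (\<lambda>z. ennreal (g z)) (\<lambda>x. ereal (f x))"
  unfolding upper_gradient_def
  using assms curve_integral_ge[OF _ _ assms(2), of _ _ _ g f] by auto

section \<open>Doubling measures\<close>

text \<open>This is convexity of \<open>t powr p\<close>, whose graph lies above its tangent at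
  \<open>a\<close>; it is Young's inequality with exponents \<open>p\<close> and
  \<open>p / (p - 1)\<close>.\<close>

lemma powr_tangent_le:
  fixes a t p :: real
  assumes "1 < p" "0 \<le> a" "0 \<le> t"
  shows "p * (t * a powr (p - 1)) \<le> t powr p + (p - 1) * a powr p"
proof -
  have "t * a powr (p - 1) \<le> t powr p / p + (a powr (p - 1)) powr (p / (p - 1)) / (p / (p - 1))"
    using assms by (intro Youngs_inequality) (auto simp: field_simps)
  also have "(a powr (p - 1)) powr (p / (p - 1)) = a powr p"
    using assms by (simp add: powr_powr)
  finally show ?thesis using assms by (simp add: field_simps)
qed

text \<open>Jensen's inequality for powers, by integrating over \<open>B\<close> the tangent
  inequality at the mean \<open>a\<close>. The linear term integrates to \<open>p * a powr p\<close>
  times the measure of \<open>B\<close>.\<close>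

lemma powr_mean_le:
  fixes h :: "'a \<Rightarrow> real"
  assumes "1 < p" and B: "B \<in> sets N" "0 < measure N B"
    and h: "set_integrable N B h" "\<And>y. 0 \<le> h y"
    and hm: "h \<in> borel_measurable N"
  shows "ennreal (((LINT y:B|N. h y) / measure N B) powr p) * ennreal (measure N B)
    \<le> (\<integral>\<^sup>+y\<in>B. ennreal (h y powr p) \<partial>N)"
proof (cases "(\<integral>\<^sup>+y\<in>B. ennreal (h y powr p) \<partial>N) = \<infinity>")
  case False
  define V where "V = measure N B"
  define J where "J = (LINT y:B|N. h y)"
  define a where "a = J / V"
  have V: "0 < V" using B by (simp add: V_def)
  \<comment> \<open>A positive \<open>measure\<close> excludes infinite \<open>emeasure\<close>, for
    which \<open>measure\<close> would be 0.\<close>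
  have emB: "emeasure N B = ennreal V"
    using B(2) unfolding V_def by (simp add: measure_def enn2real_positive_iff)
  have J0: "0 \<le> J" unfolding J_def set_lebesgue_integral_def using h(2) by (intro Bochner_Integration.integral_nonneg) auto
  have a0: "0 \<le> a" using J0 V by (simp add: a_def)
  obtain W where W: "(\<integral>\<^sup>+y\<in>B. ennreal (h y powr p) \<partial>N) = ennreal W" "0 \<le> W"
    using False by (metis ennreal_cases infinity_ennreal_def)
  have J: "(\<integral>\<^sup>+y\<in>B. ennreal (h y) \<partial>N) = ennreal J"
  proof -
    have "(\<integral>\<^sup>+y\<in>B. ennreal (h y) \<partial>N) = (\<integral>\<^sup>+y. ennreal (indicator B y *\<^sub>R h y) \<partial>N)"
      by (intro nn_integral_cong) (auto simp: indicator_def)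
    also have "\<dots> = ennreal J"
      unfolding J_def set_lebesgue_integral_def
      using h by (intro nn_integral_eq_integral) (auto simp: set_integrable_def)
    finally show ?thesis .
  qed
  have "ennreal (p * a powr (p - 1) * J) = (\<integral>\<^sup>+y. ennreal (p * a powr (p - 1)) * (ennreal (h y) * indicator B y) \<partial>N)"
    using hm B(1) J J0 assms(1) by (subst nn_integral_cmult) (auto simp: ennreal_mult)
  also have "\<dots> \<le> (\<integral>\<^sup>+y. ennreal (h y powr p) * indicator B y + ennreal ((p - 1) * a powr p) * indicator B y \<partial>N)"
  proof (intro nn_integral_mono)
    fix y
    have "p * a powr (p - 1) * h y \<le> h y powr p + (p - 1) * a powr p"
      using powr_tangent_le[of p a "h y"] assms(1) a0 h(2) by (simp add: ac_simps)
    then have "ennreal (p * a powr (p - 1) * h y) \<le> ennreal (h y powr p + (p - 1) * a powr p)"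
      by (rule ennreal_leI)
    then show "ennreal (p * a powr (p - 1)) * (ennreal (h y) * indicator B y)
      \<le> ennreal (h y powr p) * indicator B y + ennreal ((p - 1) * a powr p) * indicator B y"
      using h(2)[of y] assms(1) by (auto simp: indicator_def ennreal_mult)
  qed
  also have "\<dots> = ennreal W + ennreal ((p - 1) * a powr p) * ennreal V"
    using hm B(1) W by (subst nn_integral_add) (auto simp: nn_integral_cmult_indicator emB)
  also have "\<dots> = ennreal (W + (p - 1) * a powr p * V)"
    using W V assms(1) by (simp add: ennreal_mult)
  finally have "p * a powr (p - 1) * J \<le> W + (p - 1) * a powr p * V"
    using W V assms(1) by (subst (asm) ennreal_le_iff) auto
  moreover have "a powr (p - 1) * J = a powr p * V"
  proof (cases "a = 0")
    case False
    then have "a powr p = a powr (p - 1) * a" using a0 by (simp add: powr_diff)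
    then show ?thesis using V by (simp add: a_def)
  qed (use V a_def assms in auto)
  moreover have "p * a powr (p - 1) * J = p * (a powr (p - 1) * J)" by simp
  ultimately have "p * (a powr p * V) \<le> W + (p - 1) * (a powr p * V)" by simp
  then have "a powr p * V \<le> W" by (simp add: left_diff_distrib)
  then have "ennreal (a powr p * V) \<le> ennreal W" by (rule ennreal_leI)
  then show ?thesis
    unfolding W(1) using V by (simp add: ennreal_mult a_def V_def J_def)
qed simp

text \<open>The weight vanishes off \<open>B\<close>, so \<open>m\<close> times the restriction of
  \<open>\<bar>h\<bar>\<close> to \<open>B\<close> dominates the integrand. The weights in view are
  hat kernels and differences of two of them.\<close>

lemma integral_weight_bound:
  fixes w h :: "'a \<Rightarrow> real"
  assumes "set_integrable N B h" "w \<in> borel_measurable N"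
    and w: "\<And>y. \<bar>w y\<bar> \<le> m * indicator B y"
  shows "integrable N (\<lambda>y. w y * h y)" "\<bar>\<integral>y. w y * h y \<partial>N\<bar> \<le> m * (LINT y:B|N. \<bar>h y\<bar>)"
proof -
  have i: "integrable N (\<lambda>y. indicator B y * h y)"
    using assms(1) by (simp add: set_integrable_def)
  have eq: "w y * h y = w y * (indicator B y * h y)" for y
    using w[of y] by (cases "y \<in> B") auto
  have le: "\<bar>w y * h y\<bar> \<le> m * (indicator B y * \<bar>h y\<bar>)" for y
    using mult_right_mono[OF w[of y], of "\<bar>h y\<bar>"] by (simp add: abs_mult ac_simps)
  have i': "integrable N (\<lambda>y. m * (indicator B y * \<bar>h y\<bar>))"
    using integrable_abs[OF i] by (simp add: abs_mult)
  \<comment> \<open>Only the product of \<open>h\<close> with the indicator of \<open>B\<close> is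
    known to be measurable, so measurability is derived through it.\<close>
  have "(\<lambda>y. w y * (indicator B y * h y)) \<in> borel_measurable N"
    using assms(2) borel_measurable_integrable[OF i] by (rule borel_measurable_times)
  then have m: "(\<lambda>y. w y * h y) \<in> borel_measurable N" by (simp flip: eq)
  show "integrable N (\<lambda>y. w y * h y)"
    by (rule Bochner_Integration.integrable_bound[OF i' m]) (use le in \<open>auto intro!: AE_I2 order_trans[OF le]\<close>)
  then have i1: "integrable N (\<lambda>y. \<bar>w y * h y\<bar>)" by (rule integrable_abs)
  have "\<bar>\<integral>y. w y * h y \<partial>N\<bar> \<le> (\<integral>y. \<bar>w y * h y\<bar> \<partial>N)"
    by (rule integral_abs_bound)
  also have "\<dots> \<le> (\<integral>y. m * (indicator B y * \<bar>h y\<bar>) \<partial>N)"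
    using i1 i' le by (rule integral_mono)
  finally show "\<bar>\<integral>y. w y * h y \<partial>N\<bar> \<le> m * (LINT y:B|N. \<bar>h y\<bar>)"
    by (simp add: set_lebesgue_integral_def)
qed

section \<open>Doubling spaces and measurability of ball measures\<close>

text \<open>Doubling is phrased with the real-valued \<open>measure\<close> and a fixed
  \<open>D\<close>, to allow real arithmetic; balls have finite measure, so nothing is lost.\<close>

locale doubling_space =
  fixes M :: "'a::{metric_space, second_countable_topology} measure" and D :: real
  assumes sets_M: "sets M = sets borel"
    and emeasure_ball_pos: "0 < r \<Longrightarrow> 0 < emeasure M (ball x r)"
    and emeasure_ball_finite: "0 < r \<Longrightarrow> emeasure M (ball x r) < \<infinity>"
    and doubling: "0 < r \<Longrightarrow> measure M (ball x (2 * r)) \<le> D * measure M (ball x r)"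
begin

lemma space_M [simp]: "space M = UNIV"
  using sets_eq_imp_space_eq[OF sets_M] by simp

lemma ball_sets [measurable, simp]: "ball x r \<in> sets M"
  by (simp add: sets_M)

lemma emeasure_ball: "emeasure M (ball x r) = ennreal (measure M (ball x r))"
  using emeasure_ball_finite[of r x] by (cases "0 < r") (auto simp: emeasure_eq_ennreal_measure ball_empty)

lemma measure_ball_pos: "0 < r \<Longrightarrow> 0 < measure M (ball x r)"
  using emeasure_ball_pos[of r x] by (simp add: emeasure_ball)

lemma measure_ball_mono: "ball x r \<subseteq> ball y s \<Longrightarrow> measure M (ball x r) \<le> measure M (ball y s)"
  using emeasure_mono[of "ball x r" "ball y s" M] by (simp add: emeasure_ball)

lemma D_ge_1: "1 \<le> D"
proof -
  fix x :: 'a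
  have "measure M (ball x 1) \<le> D * measure M (ball x 1)"
    using measure_ball_mono[of x 1 x 2] doubling[of 1 x] by (simp add: subset_ball)
  then show ?thesis using measure_ball_pos[of 1 x] by simp
qed

text \<open>Balls of integer radius about any one point exhaust the space. Fubini and the
  measurability of integrals depending on a parameter rest on this.\<close>

sublocale sigma_finite_measure M
proof
  fix x :: 'a
  show "\<exists>A. countable A \<and> A \<subseteq> sets M \<and> \<Union> A = space M \<and> (\<forall>a\<in>A. emeasure M a \<noteq> \<infinity>)"
  proof (intro exI[of _ "range (\<lambda>n::nat. ball x n)"] conjI)
    show "\<Union> (range (\<lambda>n::nat. ball x n)) = space M"
      using reals_Archimedean2 by auto
  qed (auto simp: emeasure_ball)
qed

lemma pair_sigma_finite_M: "pair_sigma_finite M M" ..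

text \<open>Separability enters through the joint measurability of the distance.\<close>

lemma measurable_dist [measurable (raw)]:
  assumes "f \<in> measurable N M" "g \<in> measurable N M"
  shows "(\<lambda>w. dist (f w) (g w)) \<in> borel_measurable N"
  using assms measurable_cong_sets[OF refl sets_M, of N] by (intro borel_measurable_dist) auto

text \<open>The balls are the sections of a measurable subset of the product, hence their measures
  vary measurably.\<close>

lemma measurable_measure_ball:
  assumes [measurable]: "f \<in> measurable N M" "r \<in> borel_measurable N"
  shows "(\<lambda>w. measure M (ball (f w) (r w))) \<in> borel_measurable N"
  unfolding measure_def by (intro borel_measurable_enn2real measurable_emeasure) (simp_all add: ball_def)

end

section \<open>Averages against a hat kernel\<close>

context doubling_space
begin

text \<open>Unlike the indicator of a ball, this kernel is 1-Lipschitz in \<open>x\<close>. It is at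
  least \<open>e\<close> on \<open>ball x e\<close> and vanishes outside
  \<open>ball x (2 * e)\<close>.\<close>

definition hat_kernel :: "real \<Rightarrow> 'a \<Rightarrow> 'a \<Rightarrow> real" where
  "hat_kernel e x y = max 0 (2 * e - dist x y)"

definition hat_average :: "real \<Rightarrow> ('a \<Rightarrow> real) \<Rightarrow> 'a \<Rightarrow> real" where
  "hat_average e u x = (\<integral>y. hat_kernel e x y * u y \<partial>M) / (\<integral>y. hat_kernel e x y \<partial>M)"

text \<open>The constant is the one that \<open>hat_average_diff\<close> produces:
  \<open>D^2\<close> from the change of the numerator of the average and \<open>2 * D^4\<close> from
  the change of its denominator.\<close>

definition osc_gradient :: "real \<Rightarrow> ('a \<Rightarrow> real) \<Rightarrow> 'a \<Rightarrow> real" where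
  "osc_gradient e u z = (D^2 + 2 * D^4) / (e * measure M (ball z (3 * e))) *
     (LINT y:ball z (3 * e)|M. \<bar>u y - u z\<bar>)"

lemma measurable_hat_kernel [measurable]:
  "(\<lambda>(x, y). hat_kernel e x y) \<in> borel_measurable (M \<Otimes>\<^sub>M M)"
  unfolding hat_kernel_def by measurable

lemma measurable_hat_kernel2 [measurable]: "hat_kernel e x \<in> borel_measurable M"
  using measurable_Pair2[OF measurable_hat_kernel, of x] by simp

lemma measurable_hat_average [measurable]:
  assumes [measurable]: "u \<in> borel_measurable M"
  shows "hat_average e u \<in> borel_measurable M"
  unfolding hat_average_def by measurable

lemma measurable_osc_gradient [measurable]:
  assumes [measurable]: "u \<in> borel_measurable M"
  shows "osc_gradient e u \<in> borel_measurable M"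
  unfolding osc_gradient_def set_lebesgue_integral_def indicator_def mem_ball
  by (intro borel_measurable_times borel_measurable_divide borel_measurable_const
      measurable_measure_ball; measurable)

lemma osc_gradient_nonneg: "0 < e \<Longrightarrow> 0 \<le> osc_gradient e u z"
  unfolding osc_gradient_def set_lebesgue_integral_def
  using D_ge_1 by (intro mult_nonneg_nonneg Bochner_Integration.integral_nonneg divide_nonneg_nonneg) auto

lemma set_integrable_ball_const: "set_integrable M (ball x r) (\<lambda>_. c :: real)"
  by (simp add: set_integrable_def emeasure_ball)

lemma measure_ball_4_le:
  assumes "0 < e"
  shows "measure M (ball x (4 * e)) \<le> D^2 * measure M (ball x e)"
proof -
  have "measure M (ball x (4 * e)) \<le> D * measure M (ball x (2 * e))"
    using doubling[of "2 * e" x] assms by simp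
  also have "\<dots> \<le> D * (D * measure M (ball x e))"
    using doubling[of e x] assms D_ge_1 by (intro mult_left_mono) auto
  finally show ?thesis by (simp add: power2_eq_square mult.assoc)
qed

context
  fixes u :: "'a \<Rightarrow> real"
  assumes u_int: "\<And>x r. set_integrable M (ball x r) u"
begin

text \<open>For \<open>x\<close> within \<open>e\<close> of \<open>z\<close> the kernel lives in
  \<open>ball z (3 * e)\<close>. That ball lies in \<open>ball x (4 * e)\<close>, and two doublings
  lead back to \<open>ball x e\<close>, where the kernel is at least \<open>e\<close>. Since the
  average is normalised, a constant \<open>c\<close> can be subtracted under the integral.\<close>

lemma hat_average_eq:
  fixes c :: real
  assumes "0 < e" "dist x z < e"
  defines "B \<equiv> ball z (3 * e)"
  shows "e * measure M B / D^2 \<le> (\<integral>y. hat_kernel e x y \<partial>M)"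
    and "hat_average e u x - c = (\<integral>y. hat_kernel e x y * (u y - c) \<partial>M) / (\<integral>y. hat_kernel e x y \<partial>M)"
    and "\<bar>\<integral>y. hat_kernel e x y * (u y - c) \<partial>M\<bar> \<le> 2 * e * (LINT y:B|M. \<bar>u y - c\<bar>)"
    and "integrable M (\<lambda>y. hat_kernel e x y * (u y - c))"
    and "integrable M (hat_kernel e x)"
proof -
  have w: "\<bar>hat_kernel e x y\<bar> \<le> (2 * e) * indicator B y" for y
    using assms dist_triangle[of z y x] by (auto simp: hat_kernel_def B_def indicator_def dist_commute)
  have c: "set_integrable M B (\<lambda>y. u y - c)"
    unfolding B_def by (intro set_integral_diff u_int set_integrable_ball_const)
  show *: "integrable M (\<lambda>y. hat_kernel e x y * (u y - c))"
    and "\<bar>\<integral>y. hat_kernel e x y * (u y - c) \<partial>M\<bar> \<le> 2 * e * (LINT y:B|M. \<bar>u y - c\<bar>)"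
    using integral_weight_bound[OF c _ w] by auto
  have k: "integrable M (\<lambda>y. hat_kernel e x y * d)" for d
    using integral_weight_bound[OF set_integrable_ball_const[of z "3 * e" d, folded B_def] _ w] by auto
  show 1: "integrable M (hat_kernel e x)" using k[of 1] by simp
  have "e * measure M B \<le> e * measure M (ball x (4 * e))"
  proof (intro mult_left_mono)
    have "ball z (3 * e) \<subseteq> ball x (4 * e)"
    proof
      fix y assume "y \<in> ball z (3 * e)"
      then show "y \<in> ball x (4 * e)" using assms(2) dist_triangle[of x y z] by simp
    qed
    then show "measure M B \<le> measure M (ball x (4 * e))"
      unfolding B_def by (rule measure_ball_mono)
  qed (use assms in simp)
  also have "\<dots> \<le> e * (D^2 * measure M (ball x e))"
    using assms by (intro mult_left_mono measure_ball_4_le) auto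
  also have "\<dots> = D^2 * (\<integral>y. e * indicator (ball x e) y \<partial>M)"
    by (simp add: emeasure_ball)
  also have "\<dots> \<le> D^2 * (\<integral>y. hat_kernel e x y \<partial>M)"
  proof (intro mult_left_mono integral_mono 1)
    show "integrable M (\<lambda>y. e * indicator (ball x e) y)" by (simp add: emeasure_ball)
  qed (use assms in \<open>auto simp: hat_kernel_def indicator_def\<close>)
  finally show l: "e * measure M B / D^2 \<le> (\<integral>y. hat_kernel e x y \<partial>M)"
    using D_ge_1 by (simp add: field_simps)
  have "0 < e * measure M B / D^2"
    using assms D_ge_1 measure_ball_pos[of "3 * e" z] by (simp add: B_def)
  with l have pos: "0 < (\<integral>y. hat_kernel e x y \<partial>M)" by simp
  have "(\<integral>y. hat_kernel e x y * (u y - c) \<partial>M) + (\<integral>y. hat_kernel e x y * c \<partial>M) = (\<integral>y. hat_kernel e x y * u y \<partial>M)"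
    by (subst Bochner_Integration.integral_add[symmetric, OF * k]) (simp add: algebra_simps)
  then show "hat_average e u x - c = (\<integral>y. hat_kernel e x y * (u y - c) \<partial>M) / (\<integral>y. hat_kernel e x y \<partial>M)"
    using pos by (simp add: hat_average_def field_simps)
qed

text \<open>The kernels at \<open>x\<close> and \<open>x'\<close> differ by at most
  \<open>dist x x'\<close>, and only on \<open>B\<close>. Both the numerator and the denominator of
  the average are therefore Lipschitz, and \<open>m\<close> bounds both denominators from
  below.\<close>

lemma hat_average_diff:
  assumes e: "0 < e" and xz: "dist x z < e" "dist x' z < e"
  shows "\<bar>hat_average e u x - hat_average e u x'\<bar> \<le> dist x x' * osc_gradient e u z"
proof -
  define B where "B = ball z (3 * e)"
  define c where "c = u z"
  define V where "V = measure M B"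
  define I where "I = (LINT y:B|M. \<bar>u y - c\<bar>)"
  define \<Phi> where "\<Phi> = (\<lambda>x. \<integral>y. hat_kernel e x y \<partial>M)"
  define A where "A = (\<lambda>x. \<integral>y. hat_kernel e x y * (u y - c) \<partial>M)"
  define d where "d = dist x x'"
  note fx = hat_average_eq(1,5)[OF e xz(1), folded B_def V_def \<Phi>_def]
    hat_average_eq(2-4)[OF e xz(1), where c = c, folded B_def I_def \<Phi>_def A_def]
  note fx' = hat_average_eq(1,5)[OF e xz(2), folded B_def V_def \<Phi>_def]
    hat_average_eq(2-4)[OF e xz(2), where c = c, folded B_def I_def \<Phi>_def A_def]
  have V: "0 < V" unfolding V_def B_def using e measure_ball_pos by simp
  have D: "1 \<le> D" by (rule D_ge_1)
  have I0: "0 \<le> I" unfolding I_def set_lebesgue_integral_def by (rule Bochner_Integration.integral_nonneg) auto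
  define m where "m = e * V / D^2"
  have m: "0 < m" "m \<le> \<Phi> x" "m \<le> \<Phi> x'" using V e D fx(1) fx'(1) by (auto simp: m_def V_def \<Phi>_def)
  have w: "\<bar>hat_kernel e x y - hat_kernel e x' y\<bar> \<le> d * indicator B y" for y
  proof (cases "y \<in> B")
    case True
    then show ?thesis using dist_triangle[of x y x'] dist_triangle[of x' y x]
      by (auto simp: hat_kernel_def d_def dist_commute)
  next
    case False
    then have "2 * e \<le> dist x y" "2 * e \<le> dist x' y"
      using xz dist_triangle[of z y x] dist_triangle[of z y x'] by (auto simp: B_def dist_commute)
    with False show ?thesis by (simp add: hat_kernel_def)
  qed
  have c: "set_integrable M B (\<lambda>y. u y - c)"
    unfolding B_def by (intro set_integral_diff u_int set_integrable_ball_const)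
  have "A x - A x' = (\<integral>y. (hat_kernel e x y - hat_kernel e x' y) * (u y - c) \<partial>M)"
    unfolding A_def left_diff_distrib
    using fx(5) fx'(5) by (subst Bochner_Integration.integral_diff) auto
  then have dA: "\<bar>A x - A x'\<bar> \<le> d * I"
    using integral_weight_bound(2)[OF c _ w] by (simp add: I_def)
  have "\<Phi> x' - \<Phi> x = - (\<integral>y. (hat_kernel e x y - hat_kernel e x' y) * 1 \<partial>M)"
    unfolding \<Phi>_def using fx(2) fx'(2) by simp
  then have d\<Phi>: "\<bar>\<Phi> x' - \<Phi> x\<bar> \<le> d * V"
    using integral_weight_bound(2)[OF set_integrable_ball_const[of z "3 * e" 1, folded B_def] _ w]
    by (simp add: V_def set_lebesgue_integral_def B_def emeasure_ball)
  have A: "\<bar>A x'\<bar> \<le> 2 * e * I" using fx'(4) by (simp add: A_def I_def)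
  have "hat_average e u x - hat_average e u x' = A x / \<Phi> x - A x' / \<Phi> x'"
    using fx(3) fx'(3) by (simp add: A_def \<Phi>_def)
  \<comment> \<open>The difference of quotients is arranged so that each term contains exactly one
    difference of kernels.\<close>
  also have "\<dots> = (A x - A x') / \<Phi> x + A x' * (\<Phi> x' - \<Phi> x) / (\<Phi> x * \<Phi> x')"
    using m by (simp add: field_simps)
  finally have "\<bar>hat_average e u x - hat_average e u x'\<bar>
      \<le> \<bar>A x - A x'\<bar> / \<Phi> x + \<bar>A x'\<bar> * \<bar>\<Phi> x' - \<Phi> x\<bar> / (\<Phi> x * \<Phi> x')"
    using m abs_triangle_ineq[of "(A x - A x') / \<Phi> x" "A x' * (\<Phi> x' - \<Phi> x) / (\<Phi> x * \<Phi> x')"]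
    by (simp add: abs_mult)
  also have "\<dots> \<le> d * I / m + (2 * e * I) * (d * V) / (m * m)"
  proof (rule add_mono)
    have d: "0 \<le> d" by (simp add: d_def)
    show "\<bar>A x - A x'\<bar> / \<Phi> x \<le> d * I / m"
      using m dA d I0 by (intro frac_le) auto
    have "\<bar>A x'\<bar> * \<bar>\<Phi> x' - \<Phi> x\<bar> \<le> (2 * e * I) * (d * V)"
      using A d\<Phi> by (rule mult_mono) (use e I0 in auto)
    moreover have "m * m \<le> \<Phi> x * \<Phi> x'" using m by (intro mult_mono) auto
    ultimately show "\<bar>A x'\<bar> * \<bar>\<Phi> x' - \<Phi> x\<bar> / (\<Phi> x * \<Phi> x') \<le> (2 * e * I) * (d * V) / (m * m)"
      using m d e I0 V by (intro frac_le) auto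
  qed
  also have "\<dots> = d * ((D^2 + 2 * D^4) / (e * V) * I)"
    using e V D by (simp add: m_def field_simps power2_eq_square power4_eq_xxxx)
  finally show ?thesis
    by (simp add: osc_gradient_def d_def V_def I_def B_def c_def)
qed

text \<open>The direct estimate gives the constant \<open>2 * D^2\<close>; as
  \<open>1 \<le> D\<close> it is enlarged to that of \<open>osc_gradient\<close>, so that one
  function controls both the slope and the error.\<close>

lemma hat_average_error:
  assumes e: "0 < e"
  shows "\<bar>hat_average e u z - u z\<bar> \<le> e * osc_gradient e u z"
proof -
  define B where "B = ball z (3 * e)"
  define V where "V = measure M B"
  define I where "I = (LINT y:B|M. \<bar>u y - u z\<bar>)"
  have "dist z z < e" using e by simp
  note f = hat_average_eq(1)[OF e this, folded B_def V_def]
    hat_average_eq(2,3)[OF e this, where c = "u z", folded B_def I_def]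
  have V: "0 < V" unfolding V_def B_def using e measure_ball_pos by simp
  have D: "1 \<le> D" by (rule D_ge_1)
  have I0: "0 \<le> I" unfolding I_def set_lebesgue_integral_def by (rule Bochner_Integration.integral_nonneg) auto
  have "0 < e * V / D^2" using e V D by simp
  with f(1) have pos: "0 < (\<integral>y. hat_kernel e z y \<partial>M)" by (simp add: V_def)
  have "\<bar>hat_average e u z - u z\<bar> \<le> (2 * e * I) / (e * V / D^2)"
    unfolding f(2) abs_divide using f(1,3) pos e V D I0
    by (intro frac_le) (auto simp: V_def I_def)
  also have "\<dots> = 2 * D^2 * I / V" using e V D by (simp add: field_simps)
  also have "\<dots> \<le> (D^2 + 2 * D^4) * I / V"
  proof -
    have "D^2 \<le> D^4" using D by (simp add: power_increasing)
    moreover have "0 \<le> D^4" by simp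
    ultimately have "2 * D^2 \<le> D^2 + 2 * D^4" by linarith
    then show ?thesis using I0 V by (intro divide_right_mono mult_right_mono) auto
  qed
  also have "\<dots> = e * osc_gradient e u z"
    using e by (simp add: osc_gradient_def V_def I_def B_def)
  finally show ?thesis .
qed

lemma upper_gradient_hat_average:
  assumes "0 < e" and [measurable]: "u \<in> borel_measurable M"
  shows "upper_gradient (\<lambda>z. ennreal (osc_gradient e u z)) (\<lambda>x. ereal (hat_average e u x))"
proof (rule upper_gradientI_local)
  show "osc_gradient e u \<in> borel_measurable borel"
    by (subst measurable_cong_sets[OF sets_M[symmetric] refl]) measurable
qed (use assms osc_gradient_nonneg hat_average_diff in auto)

end

end

section \<open>Energy near the diagonal\<close>

context doubling_space
begin

definition besov_integrand :: "real \<Rightarrow> real \<Rightarrow> ('a \<Rightarrow> real) \<Rightarrow> 'a \<Rightarrow> 'a \<Rightarrow> ennreal" where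
  "besov_integrand \<theta> p u x y = (if x = y then 0 else
     ennreal (\<bar>u y - u x\<bar> powr p / (dist x y powr (\<theta> * p) * measure M (ball x (dist x y)))))"

lemma besov_energy_eq: "besov_energy M \<theta> p u = (\<integral>\<^sup>+x. \<integral>\<^sup>+y. besov_integrand \<theta> p u x y \<partial>M \<partial>M)"
  by (simp add: besov_energy_def besov_integrand_def)

lemma measurable_besov_integrand [measurable]:
  assumes [measurable]: "u \<in> borel_measurable M"
  shows "(\<lambda>(x, y). besov_integrand \<theta> p u x y) \<in> borel_measurable (M \<Otimes>\<^sub>M M)"
proof -
  define q where "q = (\<lambda>w. measure M (ball (fst w) (dist (fst w) (snd w))))"
  have [measurable]: "q \<in> borel_measurable (M \<Otimes>\<^sub>M M)"
    unfolding q_def by (rule measurable_measure_ball) measurable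
  \<comment> \<open>The diagonal is written as the zero set of the distance, which is measurable in
    the product.\<close>
  have "(\<lambda>(x, y). besov_integrand \<theta> p u x y) = (\<lambda>w. if dist (fst w) (snd w) = 0 then 0 else
     ennreal (\<bar>u (snd w) - u (fst w)\<bar> powr p / (dist (fst w) (snd w) powr (\<theta> * p) * q w)))"
    by (auto simp: fun_eq_iff besov_integrand_def q_def)
  also have "\<dots> \<in> borel_measurable (M \<Otimes>\<^sub>M M)" by measurable
  finally show ?thesis .
qed

text \<open>Monotone convergence for a decreasing sequence, with finiteness of the whole integral:
  off the diagonal the integrands are eventually 0. On the diagonal \<open>F\<close> itself must
  vanish, because points may have positive measure.\<close>

lemma near_diagonal_energy_tendsto_0:
  assumes [measurable]: "(\<lambda>(x, y). F x y) \<in> borel_measurable (M \<Otimes>\<^sub>M M)"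
    and fin: "(\<integral>\<^sup>+x. \<integral>\<^sup>+y. F x y \<partial>M \<partial>M) < (\<infinity> :: ennreal)" and diag: "\<And>x. F x x = 0"
  shows "(\<lambda>n::nat. \<integral>\<^sup>+x. \<integral>\<^sup>+y. F x y * indicator {y. dist x y < 1 / Suc n} y \<partial>M \<partial>M) \<longlonglongrightarrow> 0"
proof -
  define f where "f = (\<lambda>(n::nat) w. F (fst w) (snd w) * indicator {w. dist (fst w) (snd w) < 1 / Suc n} w)"
  have m [measurable]: "f n \<in> borel_measurable (M \<Otimes>\<^sub>M M)" for n
    unfolding f_def by measurable
  have eq: "(\<integral>\<^sup>+x. \<integral>\<^sup>+y. F x y * indicator {y. dist x y < 1 / Suc n} y \<partial>M \<partial>M) = integral\<^sup>N (M \<Otimes>\<^sub>M M) (f n)" for n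
    by (subst nn_integral_fst[symmetric, OF m]) (simp add: f_def indicator_def)
  have dec: "decseq f"
  proof (intro antimonoI le_funI)
    fix m n :: nat and w assume "m \<le> n"
    then have "1 / real (Suc n) \<le> 1 / real (Suc m)" by (simp add: field_simps)
    then show "f n w \<le> f m w" by (auto simp: f_def indicator_def)
  qed
  have "integral\<^sup>N (M \<Otimes>\<^sub>M M) (f n) < \<infinity>" for n
  proof -
    have "integral\<^sup>N (M \<Otimes>\<^sub>M M) (f n) \<le> (\<integral>\<^sup>+x. \<integral>\<^sup>+y. F x y \<partial>M \<partial>M)"
      unfolding eq[symmetric] by (intro nn_integral_mono) (auto simp: indicator_def)
    then show ?thesis using fin by (rule le_less_trans)
  qed
  from nn_integral_monotone_convergence_INF_decseq[OF dec m this]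
  have "(INF n. integral\<^sup>N (M \<Otimes>\<^sub>M M) (f n)) = (\<integral>\<^sup>+w. (INF n. f n w) \<partial>(M \<Otimes>\<^sub>M M))" by simp
  also have "\<dots> = (\<integral>\<^sup>+w. 0 \<partial>(M \<Otimes>\<^sub>M M))"
  proof (intro nn_integral_cong)
    fix w
    have "\<exists>n. f n w = 0"
    proof (cases "fst w = snd w")
      case False
      then obtain n where "inverse (real (Suc n)) < dist (fst w) (snd w)"
        using reals_Archimedean[of "dist (fst w) (snd w)"] by auto
      then show ?thesis by (intro exI[of _ n]) (simp add: f_def indicator_def field_simps)
    qed (simp add: f_def diag)
    then show "(INF n. f n w) = 0" by (metis INF_lower UNIV_I le_zero_eq)
  qed
  finally have "(INF n. integral\<^sup>N (M \<Otimes>\<^sub>M M) (f n)) = 0" by simp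
  moreover have "decseq (\<lambda>n. integral\<^sup>N (M \<Otimes>\<^sub>M M) (f n))"
    by (intro antimonoI nn_integral_mono) (use dec in \<open>blast dest: antimonoD le_funD\<close>)
  ultimately show ?thesis unfolding eq using LIMSEQ_INF by metis
qed

text \<open>Jensen's inequality bounds the power of the mean oscillation by the mean of powers.
  Inside \<open>ball z (3 * e)\<close> the denominator of the Besov integrand is at most
  \<open>(3 * e) powr p * V\<close>.\<close>

lemma osc_gradient_powr_le:
  assumes "1 < p" "1 \<le> \<theta>" "0 < e" "3 * e \<le> 1" and u: "\<And>x r. set_integrable M (ball x r) u"
    and [measurable]: "u \<in> borel_measurable M"
  shows "ennreal (osc_gradient e u z powr p) \<le>
    ennreal ((3 * (D^2 + 2 * D^4)) powr p) *
    (\<integral>\<^sup>+y. besov_integrand \<theta> p u z y * indicator {y. dist z y < 3 * e} y \<partial>M)"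
proof -
  define B where "B = ball z (3 * e)"
  define V where "V = measure M B"
  define K where "K = D^2 + 2 * D^4"
  define a where "a = (LINT y:B|M. \<bar>u y - u z\<bar>) / V"
  define W where "W = (\<integral>\<^sup>+y\<in>B. ennreal (\<bar>u y - u z\<bar> powr p) \<partial>M)"
  have V: "0 < V" unfolding V_def B_def using assms measure_ball_pos by simp
  have K: "0 < K" using D_ge_1 by (auto simp: K_def intro!: add_pos_nonneg)
  have a0: "0 \<le> a" unfolding a_def set_lebesgue_integral_def
    using V by (intro divide_nonneg_nonneg Bochner_Integration.integral_nonneg) auto
  have si: "set_integrable M B (\<lambda>y. \<bar>u y - u z\<bar>)"
    unfolding B_def by (intro set_integrable_abs set_integral_diff u set_integrable_ball_const)
  have jensen: "ennreal (a powr p) * ennreal V \<le> W"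
    unfolding a_def V_def W_def using V si assms(1)
    by (intro powr_mean_le) (auto simp: V_def B_def)
  have step: "ennreal (1 / ((3 * e) powr p * V)) * W \<le>
    (\<integral>\<^sup>+y. besov_integrand \<theta> p u z y * indicator {y. dist z y < 3 * e} y \<partial>M)"
    unfolding W_def
  proof (subst nn_integral_cmult[symmetric])
    show "(\<integral>\<^sup>+y. ennreal (1 / ((3 * e) powr p * V)) * (ennreal (\<bar>u y - u z\<bar> powr p) * indicator B y) \<partial>M)
       \<le> (\<integral>\<^sup>+y. besov_integrand \<theta> p u z y * indicator {y. dist z y < 3 * e} y \<partial>M)"
    proof (intro nn_integral_mono)
      fix y
      show "ennreal (1 / ((3 * e) powr p * V)) * (ennreal (\<bar>u y - u z\<bar> powr p) * indicator B y)
        \<le> besov_integrand \<theta> p u z y * indicator {y. dist z y < 3 * e} y"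
      proof (cases "y \<in> B \<and> y \<noteq> z")
        case True
        then have d: "0 < dist z y" "dist z y < 3 * e" by (auto simp: B_def)
        \<comment> \<open>The hypotheses \<open>1 \<le> \<theta>\<close> and
          \<open>3 * e \<le> 1\<close> meet here: for a base below 1, a larger exponent gives a
          smaller power.\<close>
        have "dist z y powr (\<theta> * p) \<le> dist z y powr p"
          using d assms by (intro powr_mono') auto
        also have "\<dots> \<le> (3 * e) powr p" using d assms by (intro powr_mono2) auto
        finally have 1: "dist z y powr (\<theta> * p) \<le> (3 * e) powr p" .
        have 2: "measure M (ball z (dist z y)) \<le> V"
          unfolding V_def B_def using d by (intro measure_ball_mono subset_ball) auto
        have "\<bar>u y - u z\<bar> powr p / ((3 * e) powr p * V) \<le>
          \<bar>u y - u z\<bar> powr p / (dist z y powr (\<theta> * p) * measure M (ball z (dist z y)))"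
          using 1 2 d measure_ball_pos[OF d(1), of z]
          by (intro divide_left_mono mult_mono mult_pos_pos) auto
        then show ?thesis using True d
          by (simp add: besov_integrand_def V less_imp_le ennreal_leI flip: ennreal_mult')
      qed (use assms(1) in \<open>auto simp: B_def\<close>)
    qed
  qed (simp add: B_def)
  have "osc_gradient e u z = K / e * a"
    by (simp add: osc_gradient_def a_def K_def V_def B_def)
  \<comment> \<open>Writing \<open>K / e\<close> as \<open>3 * K / (3 * e)\<close> brings in the
    radius of the ball, hence the factor 3 in the constant.\<close>
  then have "osc_gradient e u z powr p = (3 * K) powr p * (1 / ((3 * e) powr p * V)) * (a powr p * V)"
    using K a0 V assms(3) by (simp add: powr_mult powr_divide)
  then have "ennreal (osc_gradient e u z powr p)
      = ennreal ((3 * K) powr p) * (ennreal (1 / ((3 * e) powr p * V)) * (ennreal (a powr p) * ennreal V))"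
    using V a0 by (simp only:) (simp add: mult.assoc flip: ennreal_mult')
  also have "\<dots> \<le> ennreal ((3 * K) powr p) * (ennreal (1 / ((3 * e) powr p * V)) * W)"
    using jensen by (intro mult_left_mono) auto
  also have "\<dots> \<le> ennreal ((3 * K) powr p) *
    (\<integral>\<^sup>+y. besov_integrand \<theta> p u z y * indicator {y. dist z y < 3 * e} y \<partial>M)"
    using step by (intro mult_left_mono) auto
  finally show ?thesis by (simp add: K_def)
qed

lemma osc_gradient_energy_small:
  assumes "1 < p" "1 \<le> \<theta>" and u: "\<And>x r. set_integrable M (ball x r) u"
    and [measurable]: "u \<in> borel_measurable M"
    and fin: "besov_energy M \<theta> p u < \<infinity>" and "0 < \<eta>"
  obtains e where "0 < e" "e < \<eta>" "(\<integral>\<^sup>+z. ennreal (osc_gradient e u z powr p) \<partial>M) \<le> ennreal \<eta>"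
proof -
  define c where "c = (3 * (D^2 + 2 * D^4)) powr p"
  have c: "0 < c" unfolding c_def using D_ge_1
    by (smt (verit) powr_gt_zero zero_le_power zero_less_power)
  define T where "T = (\<lambda>n::nat. \<integral>\<^sup>+x. \<integral>\<^sup>+y. besov_integrand \<theta> p u x y * indicator {y. dist x y < 1 / Suc n} y \<partial>M \<partial>M)"
  have "T \<longlonglongrightarrow> 0"
    unfolding T_def using fin
    by (intro near_diagonal_energy_tendsto_0) (auto simp: besov_energy_eq besov_integrand_def[of _ _ _ x x for x])
  then have "\<forall>\<^sub>F n in sequentially. T n < ennreal (\<eta> / c)"
    using c \<open>0 < \<eta>\<close> by (intro order_tendstoD) auto
  moreover have "\<forall>\<^sub>F n in sequentially. 1 / real (Suc n) < \<eta>"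
    using LIMSEQ_inverse_real_of_nat \<open>0 < \<eta>\<close> by (intro order_tendstoD) (simp add: inverse_eq_divide)
  ultimately have "\<forall>\<^sub>F n in sequentially. T n < ennreal (\<eta> / c) \<and> 1 / real (Suc n) < \<eta>"
    by (rule eventually_conj)
  then obtain n where n: "T n < ennreal (\<eta> / c)" "1 / real (Suc n) < \<eta>"
    by (auto dest!: eventually_happens)
  \<comment> \<open>With this choice the averaging radius \<open>3 * e\<close> is the truncation
    radius \<open>1 / Suc n\<close>, which is at most 1.\<close>
  define e where "e = 1 / real (Suc n) / 3"
  have e: "0 < e" "3 * e = 1 / real (Suc n)" "3 * e \<le> 1" by (auto simp: e_def field_simps)
  have "(\<integral>\<^sup>+z. ennreal (osc_gradient e u z powr p) \<partial>M)
    \<le> (\<integral>\<^sup>+z. ennreal c * (\<integral>\<^sup>+y. besov_integrand \<theta> p u z y * indicator {y. dist z y < 1 / real (Suc n)} y \<partial>M) \<partial>M)"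
    using osc_gradient_powr_le[OF assms(1,2) e(1,3) u assms(4)] unfolding e(2) c_def
    by (intro nn_integral_mono)
  also have "\<dots> = ennreal c * T n"
    unfolding T_def by (subst nn_integral_cmult) (auto simp: indicator_def)
  also have "\<dots> \<le> ennreal c * ennreal (\<eta> / c)"
    using n by (intro mult_left_mono) auto
  also have "\<dots> = ennreal \<eta>" using c \<open>0 < \<eta>\<close> by (simp flip: ennreal_mult)
  finally show ?thesis using that[of e] e n by auto
qed

text \<open>On a ball, which has finite measure, \<open>\<bar>u\<bar>\<close> is dominated by
  \<open>1 + \<bar>u\<bar> powr p\<close>.\<close>

lemma Lp_set_integrable:
  assumes "1 < p" "u \<in> Lp_functions M p"
  shows "set_integrable M (ball x r) u"
proof -
  have [measurable]: "u \<in> borel_measurable M" and fin: "(\<integral>\<^sup>+x. ennreal (\<bar>u x\<bar> powr p) \<partial>M) < \<infinity>"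
    using assms by (auto simp: Lp_functions_def)
  have "(\<integral>\<^sup>+y. ennreal (norm (indicator (ball x r) y *\<^sub>R u y)) \<partial>M)
    \<le> (\<integral>\<^sup>+y. indicator (ball x r) y + ennreal (\<bar>u y\<bar> powr p) \<partial>M)"
  proof (intro nn_integral_mono)
    fix y
    have "\<bar>u y\<bar> \<le> 1 + \<bar>u y\<bar> powr p"
    proof (cases "\<bar>u y\<bar> \<le> 1")
      case False
      then have "\<bar>u y\<bar> powr 1 \<le> \<bar>u y\<bar> powr p" using assms by (intro powr_mono) auto
      then show ?thesis using False by simp
    qed (simp add: add_increasing2)
    then have "ennreal \<bar>u y\<bar> \<le> ennreal (1 + \<bar>u y\<bar> powr p)" by (rule ennreal_leI)
    then show "ennreal (norm (indicator (ball x r) y *\<^sub>R u y)) \<le> indicator (ball x r) y + ennreal (\<bar>u y\<bar> powr p)"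
      by (auto simp: indicator_def)
  qed
  also have "\<dots> = emeasure M (ball x r) + (\<integral>\<^sup>+y. ennreal (\<bar>u y\<bar> powr p) \<partial>M)"
    by (subst nn_integral_add) auto
  also have "\<dots> < \<infinity>" using fin by (simp add: emeasure_ball)
  finally show ?thesis
    unfolding set_integrable_def by (intro integrableI_bounded) measurable
qed

end

section \<open>Besov functions of order at least one\<close>

lemma ennreal_powr_mono_real:
  assumes "x \<le> ennreal a" "0 \<le> a" "0 \<le> q"
  shows "ennreal_powr x q \<le> ennreal (a powr q)"
proof -
  obtain b where b: "x = ennreal b" "0 \<le> b" "b \<le> a"
    using assms(1,2) by (cases x) (auto simp: top_unique)
  then show ?thesis using assms by (simp add: ennreal_powr_def ennreal_leI powr_mono2)
qed

lemma ennreal_powr_ennreal: "0 \<le> a \<Longrightarrow> ennreal_powr (ennreal a) q = ennreal (a powr q)"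
  by (simp add: ennreal_powr_def)

text \<open>With the constants as parameters, one choice of \<open>C\<close> and
  \<open>\<Lambda>\<close> serves all balls and all approximations.\<close>

definition poincare_with :: "'a::metric_space measure \<Rightarrow> real \<Rightarrow> real \<Rightarrow> real \<Rightarrow> bool" where
  "poincare_with M p C \<Lambda> \<longleftrightarrow> (\<forall>f g x r.
     integrable_on_balls M f \<and> upper_gradient g f \<and> 0 < r \<longrightarrow>
       (\<integral>\<^sup>+y\<in>ball x r. e2ennreal \<bar>f y - ereal (ball_mean M f x r)\<bar> \<partial>M) / emeasure M (ball x r)
       \<le> ennreal (C * r) *
          ennreal_powr
            ((\<integral>\<^sup>+y\<in>ball x (\<Lambda> * r). ennreal_powr (g y) p \<partial>M) / emeasure M (ball x (\<Lambda> * r)))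
            (1 / p))"

lemma poincare_inequality_iff:
  "poincare_inequality M p \<longleftrightarrow> (\<exists>C>0. \<exists>\<Lambda>\<ge>1. poincare_with M p C \<Lambda>)"
  unfolding poincare_inequality_def poincare_with_def ..

context doubling_space
begin

text \<open>The first term of the bound is the error of replacing \<open>u\<close> by its average
  \<open>v\<close>, the second is the Poincare inequality for \<open>v\<close>. The number
  \<open>\<eta>\<close> bounds both the scale \<open>e\<close> and the energy of \<open>G\<close>,
  so the bound vanishes as \<open>\<eta>\<close> tends to 0.\<close>

lemma poincare_hat_average:
  fixes x :: 'a
  assumes "1 < p" "1 \<le> \<theta>" and u: "u \<in> besov_space M \<theta> p"
    and C: "0 < C" "1 \<le> \<Lambda>" "0 < R"
    and poincare: "poincare_with M p C \<Lambda>"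
    and \<eta>: "0 < \<eta>"
  defines "V \<equiv> measure M (ball x R)" and "V' \<equiv> measure M (ball x (\<Lambda> * R))"
  shows "\<exists>c. (\<integral>\<^sup>+y\<in>ball x R. ennreal \<bar>u y - c\<bar> \<partial>M)
    \<le> ennreal (\<eta> * (V + \<eta>) + C * R * (\<eta> / V') powr (1 / p) * V)"
proof -
  have um [measurable]: "u \<in> borel_measurable M" and Lp: "u \<in> Lp_functions M p"
    and fin: "besov_energy M \<theta> p u < \<infinity>"
    using u by (auto simp: besov_space_def Lp_functions_def)
  have ui: "set_integrable M (ball x r) u" for x r
    using Lp_set_integrable[OF assms(1) Lp] .
  obtain e where e: "0 < e" "e < \<eta>" and small: "(\<integral>\<^sup>+z. ennreal (osc_gradient e u z powr p) \<partial>M) \<le> ennreal \<eta>"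
    using osc_gradient_energy_small[OF assms(1,2) ui um fin \<eta>] by auto
  define G where "G = osc_gradient e u"
  define v where "v = hat_average e u"
  have [measurable]: "G \<in> borel_measurable M" "v \<in> borel_measurable M"
    unfolding G_def v_def by measurable
  have G0: "0 \<le> G z" for z using osc_gradient_nonneg[OF e(1)] by (simp add: G_def)
  have err: "\<bar>v z - u z\<bar> \<le> e * G z" for z
    using hat_average_error[OF ui e(1)] by (simp add: v_def G_def)
  have V: "0 < V" "0 < V'" using C measure_ball_pos by (auto simp: V_def V'_def)
  \<comment> \<open>Only the integral of \<open>G powr p\<close> is known to be small;
    \<open>G \<le> 1 + G powr p\<close> turns it into a bound for the integral of \<open>G\<close>
    on balls. The remaining factor \<open>e\<close> makes the error small.\<close>
  have Gball: "(\<integral>\<^sup>+y\<in>ball z r. ennreal (G y) \<partial>M) \<le> ennreal (measure M (ball z r) + \<eta>)" for z r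
  proof -
    have "(\<integral>\<^sup>+y\<in>ball z r. ennreal (G y) \<partial>M) \<le> (\<integral>\<^sup>+y. indicator (ball z r) y + ennreal (G y powr p) \<partial>M)"
    proof (intro nn_integral_mono)
      fix y
      have "G y \<le> 1 + G y powr p"
      proof (cases "G y \<le> 1")
        case False
        then have "G y powr 1 \<le> G y powr p" using assms(1) by (intro powr_mono) auto
        then show ?thesis using False by simp
      qed (simp add: add_increasing2)
      then have "ennreal (G y) \<le> ennreal (1 + G y powr p)" by (rule ennreal_leI)
      then show "ennreal (G y) * indicator (ball z r) y \<le> indicator (ball z r) y + ennreal (G y powr p)"
        by (auto simp: indicator_def)
    qed
    also have "\<dots> \<le> ennreal (measure M (ball z r)) + ennreal \<eta>"
      using small by (subst nn_integral_add) (auto simp: G_def emeasure_ball intro!: add_left_mono)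
    finally show ?thesis using \<eta> by simp
  qed
  have diff: "(\<integral>\<^sup>+y\<in>ball z r. ennreal \<bar>v y - u y\<bar> \<partial>M) \<le> ennreal e * ennreal (measure M (ball z r) + \<eta>)" for z r
  proof -
    have "(\<integral>\<^sup>+y\<in>ball z r. ennreal \<bar>v y - u y\<bar> \<partial>M) \<le> (\<integral>\<^sup>+y. ennreal e * (ennreal (G y) * indicator (ball z r) y) \<partial>M)"
    proof (intro nn_integral_mono)
      fix y show "ennreal \<bar>v y - u y\<bar> * indicator (ball z r) y \<le> ennreal e * (ennreal (G y) * indicator (ball z r) y)"
        using ennreal_leI[OF err[of y]] e G0 by (auto simp: indicator_def ennreal_mult)
    qed
    also have "\<dots> = ennreal e * (\<integral>\<^sup>+y\<in>ball z r. ennreal (G y) \<partial>M)"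
      by (subst nn_integral_cmult) auto
    finally show ?thesis using Gball[of z r] by (meson mult_left_mono order_trans zero_le)
  qed
  have u_fin: "(\<integral>\<^sup>+y\<in>ball z r. ennreal \<bar>u y\<bar> \<partial>M) < \<infinity>" for z r
  proof -
    have "(\<integral>\<^sup>+y\<in>ball z r. ennreal \<bar>u y\<bar> \<partial>M) = (\<integral>\<^sup>+y. ennreal (norm (indicator (ball z r) y *\<^sub>R u y)) \<partial>M)"
      by (intro nn_integral_cong) (auto simp: indicator_def)
    then show ?thesis using ui[of z r] by (auto simp: set_integrable_def integrable_iff_bounded)
  qed
  have "integrable_on_balls M (\<lambda>y. ereal (v y))"
    unfolding integrable_on_balls_def
  proof (intro conjI allI impI)
    fix z and r :: real
    have "(\<integral>\<^sup>+y\<in>ball z r. e2ennreal \<bar>ereal (v y)\<bar> \<partial>M)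
      \<le> (\<integral>\<^sup>+y. ennreal \<bar>v y - u y\<bar> * indicator (ball z r) y + ennreal \<bar>u y\<bar> * indicator (ball z r) y \<partial>M)"
    proof (intro nn_integral_mono)
      fix y
      have "ennreal \<bar>v y\<bar> \<le> ennreal (\<bar>v y - u y\<bar> + \<bar>u y\<bar>)" by (intro ennreal_leI) linarith
      then show "e2ennreal \<bar>ereal (v y)\<bar> * indicator (ball z r) y
        \<le> ennreal \<bar>v y - u y\<bar> * indicator (ball z r) y + ennreal \<bar>u y\<bar> * indicator (ball z r) y"
        by (auto simp: indicator_def e2ennreal_ereal)
    qed
    also have "\<dots> = (\<integral>\<^sup>+y\<in>ball z r. ennreal \<bar>v y - u y\<bar> \<partial>M) + (\<integral>\<^sup>+y\<in>ball z r. ennreal \<bar>u y\<bar> \<partial>M)"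
      by (subst nn_integral_add) auto
    also have "\<dots> < \<infinity>" using le_less_trans[OF diff[of z r]] u_fin[of z r] by (simp add: ennreal_mult_less_top)
    finally show "(\<integral>\<^sup>+y\<in>ball z r. e2ennreal \<bar>ereal (v y)\<bar> \<partial>M) < \<infinity>" .
  qed measurable
  moreover have "upper_gradient (\<lambda>z. ennreal (G z)) (\<lambda>y. ereal (v y))"
    unfolding G_def v_def using upper_gradient_hat_average[OF ui e(1) um] .
  ultimately have P: "(\<integral>\<^sup>+y\<in>ball x R. e2ennreal \<bar>ereal (v y) - ereal (ball_mean M (\<lambda>y. ereal (v y)) x R)\<bar> \<partial>M) / emeasure M (ball x R)
       \<le> ennreal (C * R) *
          ennreal_powr ((\<integral>\<^sup>+y\<in>ball x (\<Lambda> * R). ennreal_powr (ennreal (G y)) p \<partial>M) / emeasure M (ball x (\<Lambda> * R))) (1 / p)"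
    using C poincare unfolding poincare_with_def by blast
  define c where "c = ball_mean M (\<lambda>y. ereal (v y)) x R"
  have "(\<integral>\<^sup>+y\<in>ball x (\<Lambda> * R). ennreal_powr (ennreal (G y)) p \<partial>M) \<le> ennreal \<eta>"
    using G0 by (intro order_trans[OF nn_integral_mono small])
      (auto simp: indicator_def ennreal_powr_ennreal G_def)
  then have "(\<integral>\<^sup>+y\<in>ball x (\<Lambda> * R). ennreal_powr (ennreal (G y)) p \<partial>M) / emeasure M (ball x (\<Lambda> * R)) \<le> ennreal (\<eta> / V')"
    using V \<eta> by (simp add: emeasure_ball V'_def divide_right_mono_ennreal flip: divide_ennreal)
  then have "ennreal (C * R) *
          ennreal_powr ((\<integral>\<^sup>+y\<in>ball x (\<Lambda> * R). ennreal_powr (ennreal (G y)) p \<partial>M) / emeasure M (ball x (\<Lambda> * R))) (1 / p)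
     \<le> ennreal (C * R) * ennreal ((\<eta> / V') powr (1 / p))"
    using V \<eta> assms(1) by (intro mult_left_mono ennreal_powr_mono_real) auto
  with P have "(\<integral>\<^sup>+y\<in>ball x R. ennreal \<bar>v y - c\<bar> \<partial>M) / ennreal V
      \<le> ennreal (C * R) * ennreal ((\<eta> / V') powr (1 / p))"
    by (simp add: c_def emeasure_ball V_def e2ennreal_ereal)
  \<comment> \<open>Multiplication by \<open>V\<close> clears the mean value on the left.\<close>
  then have "(\<integral>\<^sup>+y\<in>ball x R. ennreal \<bar>v y - c\<bar> \<partial>M) / ennreal V * ennreal V
      \<le> ennreal (C * R) * ennreal ((\<eta> / V') powr (1 / p)) * ennreal V"
    by (rule mult_right_mono) simp
  then have vc: "(\<integral>\<^sup>+y\<in>ball x R. ennreal \<bar>v y - c\<bar> \<partial>M) \<le> ennreal (C * R * (\<eta> / V') powr (1 / p) * V)"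
    using V C by (simp add: ennreal_divide_times ennreal_times_divide[symmetric] ennreal_mult)
  have "(\<integral>\<^sup>+y\<in>ball x R. ennreal \<bar>u y - c\<bar> \<partial>M)
    \<le> (\<integral>\<^sup>+y. ennreal \<bar>v y - u y\<bar> * indicator (ball x R) y + ennreal \<bar>v y - c\<bar> * indicator (ball x R) y \<partial>M)"
  proof (intro nn_integral_mono)
    fix y
    have "ennreal \<bar>u y - c\<bar> \<le> ennreal (\<bar>v y - u y\<bar> + \<bar>v y - c\<bar>)" by (intro ennreal_leI) linarith
    then show "ennreal \<bar>u y - c\<bar> * indicator (ball x R) y
        \<le> ennreal \<bar>v y - u y\<bar> * indicator (ball x R) y + ennreal \<bar>v y - c\<bar> * indicator (ball x R) y"
      by (auto simp: indicator_def)
  qed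
  also have "\<dots> = (\<integral>\<^sup>+y\<in>ball x R. ennreal \<bar>v y - u y\<bar> \<partial>M) + (\<integral>\<^sup>+y\<in>ball x R. ennreal \<bar>v y - c\<bar> \<partial>M)"
    by (subst nn_integral_add) auto
  also have "\<dots> \<le> ennreal (\<eta> * (V + \<eta>)) + ennreal (C * R * (\<eta> / V') powr (1 / p) * V)"
  proof (intro add_mono vc)
    have "(\<integral>\<^sup>+y\<in>ball x R. ennreal \<bar>v y - u y\<bar> \<partial>M) \<le> ennreal (e * (V + \<eta>))"
      using diff[of x R] e V \<eta> by (simp add: V_def ennreal_mult)
    also have "\<dots> \<le> ennreal (\<eta> * (V + \<eta>))"
      using e V \<eta> by (intro ennreal_leI mult_right_mono) auto
    finally show "(\<integral>\<^sup>+y\<in>ball x R. ennreal \<bar>v y - u y\<bar> \<partial>M) \<le> ennreal (\<eta> * (V + \<eta>))" .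
  qed
  also have "\<dots> = ennreal (\<eta> * (V + \<eta>) + C * R * (\<eta> / V') powr (1 / p) * V)"
    using V C \<eta> by (intro ennreal_plus[symmetric] mult_nonneg_nonneg) auto
  finally show ?thesis by blast
qed

text \<open>The space has positive measure, so some \<open>x\<close> is not exceptional; its value
  \<open>u x\<close> is the constant.\<close>

lemma ae_constant_if_double_AE:
  assumes "AE x in M. AE y in M. u x = u y"
  shows "ae_constant M u"
proof -
  have "emeasure M UNIV \<noteq> 0"
    using emeasure_ball_pos[of 1 undefined] emeasure_mono[of "ball undefined 1" UNIV M] sets_M
    by auto
  then have "\<not> (AE x in M. False)"
    using AE_iff_measurable[of UNIV M "\<lambda>_. False"] sets_M by simp
  moreover have "AE x in M. False" if "\<And>x. \<not> (AE y in M. u x = u y)"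
    using assms by eventually_elim (use that in blast)
  ultimately obtain x where "AE y in M. u x = u y" by blast
  then show ?thesis unfolding ae_constant_def by (intro exI[of _ "u x"]) auto
qed

lemma besov_ae_constant:
  assumes "1 < p" "1 \<le> \<theta>" and u: "u \<in> besov_space M \<theta> p" and P: "poincare_inequality M p"
  shows "ae_constant M u"
proof -
  have [measurable]: "u \<in> borel_measurable M"
    using u by (auto simp: besov_space_def Lp_functions_def)
  obtain C \<Lambda> where C: "0 < C" "1 \<le> \<Lambda>"
    and poincare: "poincare_with M p C \<Lambda>"
    using P unfolding poincare_inequality_iff by blast
  fix x0 :: 'a
  have loc: "AE x in M. x \<in> ball x0 R \<longrightarrow> (AE y in M. y \<in> ball x0 R \<longrightarrow> u x = u y)" if R: "0 < R" for R
  proof -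
    define B where "B = ball x0 R"
    define V where "V = measure M B"
    define V' where "V' = measure M (ball x0 (\<Lambda> * R))"
    have V: "0 < V" "0 < V'" using C R measure_ball_pos by (auto simp: V_def V'_def B_def)
    have [measurable]: "B \<in> sets M" by (simp add: B_def)
    \<comment> \<open>The constant supplied by \<open>poincare_hat_average\<close> changes with
      \<open>\<eta>\<close>. Integrating over pairs eliminates it, so no limit of constants is
      required.\<close>
    define J where "J = (\<integral>\<^sup>+x. \<integral>\<^sup>+y. ennreal \<bar>u x - u y\<bar> * indicator B y * indicator B x \<partial>M \<partial>M)"
    have le: "J \<le> ennreal (2 * V * (\<eta> * (V + \<eta>) + C * R * (\<eta> / V') powr (1 / p) * V))" if eta: "0 < \<eta>" for \<eta>
    proof -
      define \<delta> where "\<delta> = \<eta> * (V + \<eta>) + C * R * (\<eta> / V') powr (1 / p) * V"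
      obtain c where c: "(\<integral>\<^sup>+y\<in>B. ennreal \<bar>u y - c\<bar> \<partial>M) \<le> ennreal \<delta>"
        using poincare_hat_average[OF assms(1-3) C R poincare eta, of x0] unfolding B_def V_def V'_def \<delta>_def by auto
      have "J \<le> (\<integral>\<^sup>+x. \<integral>\<^sup>+y. ennreal \<bar>u x - c\<bar> * indicator B x * indicator B y + ennreal \<bar>u y - c\<bar> * indicator B y * indicator B x \<partial>M \<partial>M)"
        unfolding J_def
      proof (intro nn_integral_mono)
        fix x y
        have "ennreal \<bar>u x - u y\<bar> \<le> ennreal (\<bar>u x - c\<bar> + \<bar>u y - c\<bar>)" by (intro ennreal_leI) linarith
        then show "ennreal \<bar>u x - u y\<bar> * indicator B y * indicator B x
          \<le> ennreal \<bar>u x - c\<bar> * indicator B x * indicator B y + ennreal \<bar>u y - c\<bar> * indicator B y * indicator B x"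
          by (auto simp: indicator_def)
      qed
      also have "\<dots> = (\<integral>\<^sup>+x. ennreal \<bar>u x - c\<bar> * indicator B x * ennreal V + (\<integral>\<^sup>+y\<in>B. ennreal \<bar>u y - c\<bar> \<partial>M) * indicator B x \<partial>M)"
      proof (intro nn_integral_cong)
        fix x
        have "(\<integral>\<^sup>+y. ennreal \<bar>u x - c\<bar> * indicator B x * indicator B y + ennreal \<bar>u y - c\<bar> * indicator B y * indicator B x \<partial>M)
          = (\<integral>\<^sup>+y. ennreal \<bar>u x - c\<bar> * indicator B x * indicator B y \<partial>M) + (\<integral>\<^sup>+y. ennreal \<bar>u y - c\<bar> * indicator B y * indicator B x \<partial>M)"
          by (rule nn_integral_add) auto
        then show "(\<integral>\<^sup>+y. ennreal \<bar>u x - c\<bar> * indicator B x * indicator B y + ennreal \<bar>u y - c\<bar> * indicator B y * indicator B x \<partial>M)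
          = ennreal \<bar>u x - c\<bar> * indicator B x * ennreal V + (\<integral>\<^sup>+y\<in>B. ennreal \<bar>u y - c\<bar> \<partial>M) * indicator B x"
          by (simp add: nn_integral_cmult nn_integral_multc V_def B_def emeasure_ball)
      qed
      also have "\<dots> = (\<integral>\<^sup>+y\<in>B. ennreal \<bar>u y - c\<bar> \<partial>M) * ennreal V + (\<integral>\<^sup>+y\<in>B. ennreal \<bar>u y - c\<bar> \<partial>M) * ennreal V"
        by (subst nn_integral_add) (auto simp: nn_integral_multc nn_integral_cmult V_def B_def emeasure_ball)
      also have "\<dots> \<le> ennreal \<delta> * ennreal V + ennreal \<delta> * ennreal V"
        using c by (intro add_mono mult_right_mono) auto
      also have "\<dots> = ennreal (2 * V * \<delta>)"
        using V C R eta by (simp add: \<delta>_def ac_simps flip: ennreal_plus ennreal_mult)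
      finally show ?thesis by (simp add: \<delta>_def)
    qed
    have "J = 0"
    proof (rule ccontr)
      assume "J \<noteq> 0"
      have lim: "((\<lambda>\<eta>. 2 * V * (\<eta> * (V + \<eta>) + C * R * (\<eta> / V') powr (1 / p) * V)) \<longlongrightarrow> 0) (at_right 0)"
      proof -
        \<comment> \<open>The base tends to 0, and the limit rule for \<open>powr\<close> then asks
          for a base that is eventually nonnegative.\<close>
        have ev: "\<forall>\<^sub>F \<eta> in at_right 0. 0 \<le> \<eta> / V'"
          using eventually_at_right_less by (rule eventually_mono) (use V in auto)
        show ?thesis using V assms(1) by (auto intro!: tendsto_eq_intros ev)
      qed
      have "J < \<infinity>" using le[of 1] by (simp add: le_less_trans)
      then obtain j where j: "J = ennreal j" "0 < j" using \<open>J \<noteq> 0\<close> by (cases J) auto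
      from order_tendstoD(2)[OF lim j(2)] eventually_at_right_less[of 0]
      have "\<forall>\<^sub>F \<eta> in at_right 0. 0 < \<eta> \<and> 2 * V * (\<eta> * (V + \<eta>) + C * R * (\<eta> / V') powr (1 / p) * V) < j"
        by eventually_elim auto
      then obtain \<eta> where "0 < \<eta>" "2 * V * (\<eta> * (V + \<eta>) + C * R * (\<eta> / V') powr (1 / p) * V) < j"
        by (auto dest!: eventually_happens)
      then show False using le[of \<eta>] j by (smt (verit) ennreal_le_iff2)
    qed
    then have "AE x in M. (\<integral>\<^sup>+y. ennreal \<bar>u x - u y\<bar> * indicator B y * indicator B x \<partial>M) = 0"
      unfolding J_def by (subst (asm) nn_integral_0_iff_AE) auto
    then show ?thesis
    proof eventually_elim
      case (elim x)
      then have "AE y in M. ennreal \<bar>u x - u y\<bar> * indicator B y * indicator B x = 0"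
        by (subst (asm) nn_integral_0_iff_AE) auto
      then show ?case by (auto simp: B_def indicator_def)
    qed
  qed
  \<comment> \<open>Countably many balls about \<open>x0\<close> suffice; \<open>Suc n\<close> keeps
    their radii positive, as \<open>loc\<close> demands.\<close>
  have "AE x in M. \<forall>n. x \<in> ball x0 (real (Suc n)) \<longrightarrow> (AE y in M. y \<in> ball x0 (real (Suc n)) \<longrightarrow> u x = u y)"
    unfolding AE_all_countable using loc[of "real (Suc n)" for n] by auto
  then have "AE x in M. AE y in M. u x = u y"
  proof eventually_elim
    case (elim x)
    obtain m :: nat where m: "dist x0 x < real m" using reals_Archimedean2 by blast
    \<comment> \<open>Radii beyond \<open>m\<close> place \<open>x\<close> in every ball, so that
      only the condition on \<open>y\<close> remains.\<close>
    have "AE y in M. \<forall>n. y \<in> ball x0 (real (Suc (m + n))) \<longrightarrow> u x = u y"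
      unfolding AE_all_countable
    proof
      fix n
      show "AE y in M. y \<in> ball x0 (real (Suc (m + n))) \<longrightarrow> u x = u y"
        using elim[rule_format, of "m + n"] m by simp
    qed
    then show ?case
    proof eventually_elim
      case (elim y)
      obtain k :: nat where "dist x0 y < real k" using reals_Archimedean2 by blast
      then show ?case using elim[rule_format, of k] by simp
    qed
  qed
  then show ?thesis by (rule ae_constant_if_double_AE)
qed

end

section \<open>Besov functions of order below one\<close>

context doubling_space
begin

section \<open>Integration over dyadic annuli\<close>

text \<open>On \<open>A\<close> the function is dominated by a series of multiples of ball
  indicators, and the \<open>k\<close>-th term of that series has integral
  \<open>a k\<close>.\<close>

lemma nn_integral_ball_cover_le:
  fixes f :: "'a \<Rightarrow> ennreal" and a \<rho> :: "nat \<Rightarrow> real"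
  assumes "\<And>k. 0 < \<rho> k" "\<And>k. 0 \<le> a k" "summable a"
    and f: "\<And>y. y \<in> A \<Longrightarrow> \<exists>k. y \<in> ball x (\<rho> k) \<and> f y \<le> ennreal (a k / measure M (ball x (\<rho> k)))"
  shows "(\<integral>\<^sup>+y\<in>A. f y \<partial>M) \<le> ennreal (suminf a)"
proof -
  define t where "t = (\<lambda>k y. ennreal (a k / measure M (ball x (\<rho> k))) * indicator (ball x (\<rho> k)) y)"
  have "(\<integral>\<^sup>+y\<in>A. f y \<partial>M) \<le> (\<integral>\<^sup>+y. (\<Sum>k. t k y) \<partial>M)"
  proof (intro nn_integral_mono)
    fix y
    show "f y * indicator A y \<le> (\<Sum>k. t k y)"
    proof (cases "y \<in> A")
      case True
      then obtain k where k: "y \<in> ball x (\<rho> k)" "f y \<le> ennreal (a k / measure M (ball x (\<rho> k)))"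
        using f by blast
      then have "f y \<le> t k y" by (simp add: t_def)
      also have "\<dots> \<le> (\<Sum>k. t k y)" using sum_le_suminf[of "\<lambda>k. t k y" "{k}"] by simp
      finally show ?thesis using True by simp
    qed simp
  qed
  also have "\<dots> = (\<Sum>k. \<integral>\<^sup>+y. t k y \<partial>M)"
    by (rule nn_integral_suminf) (simp add: t_def)
  also have "\<dots> = (\<Sum>k. ennreal (a k))"
  proof (intro suminf_cong)
    fix k
    show "(\<integral>\<^sup>+y. t k y \<partial>M) = ennreal (a k)"
      unfolding t_def using assms measure_ball_pos[of "\<rho> k" x]
      by (simp add: nn_integral_cmult_indicator emeasure_ball flip: ennreal_mult')
  qed
  also have "\<dots> = ennreal (suminf a)"
    using assms by (intro suminf_ennreal2)
  finally show ?thesis .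
qed

lemma measure_ball_half_le:
  assumes "0 < \<rho>" "\<rho> / 2 \<le> d"
  shows "measure M (ball x \<rho>) \<le> D * measure M (ball x d)"
proof -
  have "measure M (ball x \<rho>) \<le> D * measure M (ball x (\<rho> / 2))"
    using doubling[of "\<rho> / 2" x] assms by simp
  also have "\<dots> \<le> D * measure M (ball x d)"
    using assms D_ge_1 by (intro mult_left_mono measure_ball_mono subset_ball) auto
  finally show ?thesis .
qed

text \<open>One doubling replaces the ball of variable radius \<open>d\<close> by the fixed ball of
  radius \<open>\<rho>\<close>, the form that \<open>nn_integral_ball_cover_le\<close>
  expects.\<close>

lemma kernel_le_on_annulus:
  assumes "0 < \<rho>" "\<rho> / 2 \<le> d" "s \<le> t" "0 \<le> t"
  shows "s / measure M (ball x d) \<le> D * t / measure M (ball x \<rho>)"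
proof -
  have "0 < d" using assms by simp
  note pos = measure_ball_pos[OF this, of x] measure_ball_pos[OF assms(1), of x]
  have "s / measure M (ball x d) \<le> t / measure M (ball x d)"
    using assms pos by (intro divide_right_mono) auto
  also have "\<dots> \<le> t * (D / measure M (ball x \<rho>))"
    using mult_left_mono[OF measure_ball_half_le[OF assms(1,2), of x] assms(4)] pos
    by (simp add: field_simps)
  finally show ?thesis by (simp add: ac_simps)
qed

text \<open>\<open>k\<close> precedes the least \<open>n\<close> with
  \<open>R / 2 ^ n \<le> d\<close>; this \<open>n\<close> is not 0 because
  \<open>d < R\<close>.\<close>

lemma dyadic_annulus_below:
  fixes d R :: real
  assumes "0 < d" "d < R"
  obtains k :: nat where "R / 2 ^ k / 2 \<le> d" "d < R / 2 ^ k"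
proof -
  define n where "n = (LEAST n. R / 2 ^ n \<le> d)"
  have "\<exists>n. R / 2 ^ n \<le> d"
    using real_arch_pow_inv[of "d / R" "1/2"] assms by (auto simp: field_simps intro: less_imp_le)
  then have n: "R / 2 ^ n \<le> d" unfolding n_def by (rule LeastI_ex)
  with assms have "n \<noteq> 0" by (cases n) auto
  then obtain k where k: "n = Suc k" by (cases n) auto
  have "\<not> R / 2 ^ k \<le> d" using not_less_Least[of k "\<lambda>n. R / 2 ^ n \<le> d"] k by (simp add: n_def)
  then show ?thesis using that[of k] n k by (simp add: field_simps)
qed

lemma dyadic_annulus_above:
  fixes d R :: real
  assumes "0 < R" "R \<le> d"
  obtains k :: nat where "R * 2 ^ k \<le> d" "d < 2 * (R * 2 ^ k)"
proof -
  define n where "n = (LEAST n. d < R * 2 ^ n)"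
  have "\<exists>n. d < R * 2 ^ n"
    using real_arch_pow[of 2 "d / R"] assms by (auto simp: field_simps)
  then have n: "d < R * 2 ^ n" unfolding n_def by (rule LeastI_ex)
  with assms have "n \<noteq> 0" by (cases n) auto
  then obtain k where k: "n = Suc k" by (cases n) auto
  have "\<not> d < R * 2 ^ k" using not_less_Least[of k "\<lambda>n. d < R * 2 ^ n"] k by (simp add: n_def)
  then show ?thesis using that[of k] n k by (simp add: field_simps)
qed

section \<open>A majorant for the energy of cones\<close>

text \<open>This majorises the Besov integrand of any 1-Lipschitz function with values between 0 and
  \<open>R\<close>, as two of its values differ by at most \<open>min (dist x y) R\<close>.\<close>

definition truncated_kernel :: "real \<Rightarrow> real \<Rightarrow> real \<Rightarrow> 'a \<Rightarrow> 'a \<Rightarrow> ennreal" where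
  "truncated_kernel R \<theta> p x y = (if x = y then 0 else
     ennreal ((min (dist x y) R) powr p / (dist x y powr (\<theta> * p) * measure M (ball x (dist x y)))))"

lemma measurable_truncated_kernel [measurable]:
  "(\<lambda>(x, y). truncated_kernel R \<theta> p x y) \<in> borel_measurable (M \<Otimes>\<^sub>M M)"
proof -
  define q where "q = (\<lambda>w. measure M (ball (fst w) (dist (fst w) (snd w))))"
  have [measurable]: "q \<in> borel_measurable (M \<Otimes>\<^sub>M M)"
    unfolding q_def by (rule measurable_measure_ball) measurable
  have "(\<lambda>(x, y). truncated_kernel R \<theta> p x y) = (\<lambda>w. if dist (fst w) (snd w) = 0 then 0 else
     ennreal ((min (dist (fst w) (snd w)) R) powr p / (dist (fst w) (snd w) powr (\<theta> * p) * q w)))"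
    by (auto simp: fun_eq_iff truncated_kernel_def q_def)
  also have "\<dots> \<in> borel_measurable (M \<Otimes>\<^sub>M M)" by measurable
  finally show ?thesis .
qed

text \<open>The only asymmetry is the centre of the ball, and \<open>ball y d\<close> lies in
  \<open>ball x (2 * d)\<close>.\<close>

lemma truncated_kernel_swap:
  "truncated_kernel R \<theta> p x y \<le> ennreal D * truncated_kernel R \<theta> p y x"
proof (cases "x = y")
  case False
  define d where "d = dist x y"
  have d: "0 < d" using False by (simp add: d_def)
  have "ball y d \<subseteq> ball x (2 * d)"
  proof
    fix z assume "z \<in> ball y d"
    then show "z \<in> ball x (2 * d)" using dist_triangle[of x z y] by (simp add: d_def)
  qed
  then have "measure M (ball y d) \<le> measure M (ball x (2 * d))" by (rule measure_ball_mono)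
  also have "\<dots> \<le> D * measure M (ball x d)" using doubling d .
  finally have le: "measure M (ball y d) \<le> D * measure M (ball x d)" .
  define N where "N = (min d R) powr p / d powr (\<theta> * p)"
  have N: "0 \<le> N" by (simp add: N_def)
  have "N / measure M (ball x d) \<le> D * (N / measure M (ball y d))"
    using mult_left_mono[OF le N] measure_ball_pos[OF d, of x] measure_ball_pos[OF d, of y]
    by (simp add: field_simps)
  then show ?thesis
    using False D_ge_1 unfolding truncated_kernel_def
    by (simp add: dist_commute[of y x] d_def[symmetric] N_def ennreal_leI flip: ennreal_mult')
qed (simp add: truncated_kernel_def)

text \<open>Up to the ball measure the kernel is \<open>d powr \<alpha>\<close> for
  \<open>d < R\<close> and \<open>R powr p * d powr - \<beta>\<close> beyond. The geometric series
  over the annuli converge since \<open>\<alpha>\<close> and \<open>\<beta>\<close> are positive,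
  which is where \<open>\<theta> < 1\<close> and \<open>0 < \<theta>\<close> enter. The bound does
  not depend on \<open>x\<close>.\<close>

lemma truncated_kernel_integral_bounded:
  assumes "0 < R" "0 < \<theta>" "\<theta> < 1" "0 < p"
  obtains S :: real where "\<And>x. (\<integral>\<^sup>+y. truncated_kernel R \<theta> p x y \<partial>M) \<le> ennreal S"
proof -
  define \<alpha> where "\<alpha> = (1 - \<theta>) * p"
  define \<beta> where "\<beta> = \<theta> * p"
  have \<alpha>: "0 < \<alpha>" "0 < \<beta>" using assms by (auto simp: \<alpha>_def \<beta>_def)
  have half: "(2::real) powr - s < 1" if "0 < s" for s using powr_less_mono[of "- s" 0 2] that by simp
  define a where "a = (\<lambda>k::nat. D * (R / 2 ^ k) powr \<alpha>)"
  define b where "b = (\<lambda>k::nat. D * (R powr p * (R * 2 ^ k) powr - \<beta>))"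
  have a: "0 \<le> a k" and b: "0 \<le> b k" for k using D_ge_1 by (auto simp: a_def b_def)
  have pw: "(2 ^ k) powr s = (2 powr s) ^ k" for k :: nat and s :: real
    by (simp add: powr_powr powr_power mult.commute flip: powr_realpow)
  have "a = (\<lambda>k. D * R powr \<alpha> * (2 powr - \<alpha>) ^ k)"
  proof
    fix k
    have "(R / 2 ^ k) powr \<alpha> = R powr \<alpha> / (2 powr \<alpha>) ^ k"
      using assms(1) by (simp add: powr_divide pw)
    then show "a k = D * R powr \<alpha> * (2 powr - \<alpha>) ^ k"
      by (simp add: a_def powr_minus power_inverse divide_inverse)
  qed
  moreover have "b = (\<lambda>k. D * R powr p * R powr - \<beta> * (2 powr - \<beta>) ^ k)"
    using assms(1) by (auto simp: b_def powr_mult pw)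
  ultimately have sum: "summable a" "summable b"
    using half[OF \<alpha>(1)] half[OF \<alpha>(2)] by (auto intro!: summable_mult summable_geometric)
  have "(\<integral>\<^sup>+y. truncated_kernel R \<theta> p x y \<partial>M) \<le> ennreal (suminf a + suminf b)" for x
  proof -
    have near: "(\<integral>\<^sup>+y\<in>{y. 0 < dist x y \<and> dist x y < R}. truncated_kernel R \<theta> p x y \<partial>M) \<le> ennreal (suminf a)"
    proof (rule nn_integral_ball_cover_le[where \<rho> = "\<lambda>k. R / 2 ^ k"])
      fix y assume "y \<in> {y. 0 < dist x y \<and> dist x y < R}"
      then have y: "0 < dist x y" "dist x y < R" by auto
      then obtain k where k: "R / 2 ^ k / 2 \<le> dist x y" "dist x y < R / 2 ^ k"
        by (rule dyadic_annulus_below)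
      have "dist x y powr \<alpha> / measure M (ball x (dist x y)) \<le> D * (R / 2 ^ k) powr \<alpha> / measure M (ball x (R / 2 ^ k))"
        using k y \<alpha> assms by (intro kernel_le_on_annulus powr_mono2) auto
      moreover have "truncated_kernel R \<theta> p x y = ennreal (dist x y powr \<alpha> / measure M (ball x (dist x y)))"
        using y by (simp add: truncated_kernel_def \<alpha>_def left_diff_distrib powr_diff min_def)
      ultimately show "\<exists>k. y \<in> ball x (R / 2 ^ k) \<and>
          truncated_kernel R \<theta> p x y \<le> ennreal (a k / measure M (ball x (R / 2 ^ k)))"
        using k by (intro exI[of _ k]) (auto simp: a_def intro!: ennreal_leI)
    qed (use assms a sum in auto)
    have far: "(\<integral>\<^sup>+y\<in>{y. R \<le> dist x y}. truncated_kernel R \<theta> p x y \<partial>M) \<le> ennreal (suminf b)"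
    \<comment> \<open>The covering ball has the outer radius of the annulus, twice the inner
      one.\<close>
    proof (rule nn_integral_ball_cover_le[where \<rho> = "\<lambda>k. 2 * (R * 2 ^ k)"])
      fix y assume "y \<in> {y. R \<le> dist x y}"
      then have y: "R \<le> dist x y" "0 < dist x y" using assms(1) by auto
      obtain k where k: "R * 2 ^ k \<le> dist x y" "dist x y < 2 * (R * 2 ^ k)"
        using dyadic_annulus_above[OF assms(1) y(1)] by blast
      have "R powr p * dist x y powr - \<beta> / measure M (ball x (dist x y))
          \<le> D * (R powr p * (R * 2 ^ k) powr - \<beta>) / measure M (ball x (2 * (R * 2 ^ k)))"
        using k y \<alpha> assms by (intro kernel_le_on_annulus mult_left_mono powr_mono2') auto
      moreover have "truncated_kernel R \<theta> p x y = ennreal (R powr p * dist x y powr - \<beta> / measure M (ball x (dist x y)))"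
        using y by (auto simp: truncated_kernel_def \<beta>_def min_def powr_minus field_simps)
      ultimately show "\<exists>k. y \<in> ball x (2 * (R * 2 ^ k)) \<and>
          truncated_kernel R \<theta> p x y \<le> ennreal (b k / measure M (ball x (2 * (R * 2 ^ k))))"
        using k by (intro exI[of _ k]) (auto simp: b_def intro!: ennreal_leI)
    qed (use assms b sum in auto)
    have [measurable]: "(\<lambda>y. truncated_kernel R \<theta> p x y) \<in> borel_measurable M"
      using measurable_Pair2[OF measurable_truncated_kernel, of x] by simp
    have "(\<integral>\<^sup>+y. truncated_kernel R \<theta> p x y \<partial>M) =
      (\<integral>\<^sup>+y. truncated_kernel R \<theta> p x y * indicator {y. 0 < dist x y \<and> dist x y < R} y
        + truncated_kernel R \<theta> p x y * indicator {y. R \<le> dist x y} y \<partial>M)"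
      using assms(1) by (intro nn_integral_cong) (auto simp: indicator_def truncated_kernel_def)
    also have "\<dots> = (\<integral>\<^sup>+y\<in>{y. 0 < dist x y \<and> dist x y < R}. truncated_kernel R \<theta> p x y \<partial>M)
        + (\<integral>\<^sup>+y\<in>{y. R \<le> dist x y}. truncated_kernel R \<theta> p x y \<partial>M)"
      unfolding indicator_def by (rule nn_integral_add) measurable
    also have "\<dots> \<le> ennreal (suminf a) + ennreal (suminf b)" using near far by (rule add_mono)
    finally show ?thesis using sum a b by (simp add: suminf_nonneg)
  qed
  then show ?thesis by (rule that)
qed

section \<open>Cones as non-constant Besov functions\<close>

definition cone :: "'a \<Rightarrow> real \<Rightarrow> 'a \<Rightarrow> real" where
  "cone x0 R y = max 0 (R - dist x0 y)"

text \<open>The integrand vanishes unless \<open>x\<close> or \<open>y\<close> lies in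
  \<open>B\<close>. Pairs with \<open>y\<close> in \<open>B\<close> are reflected by
  \<open>truncated_kernel_swap\<close>, so in both cases the kernel is integrated freely around a
  centre that ranges over \<open>B\<close>, a set of finite measure.\<close>

lemma cone_in_besov_space:
  assumes "0 < R" "0 < \<theta>" "\<theta> < 1" "0 < p"
  shows "cone x0 R \<in> besov_space M \<theta> p"
proof -
  define B where "B = ball x0 R"
  have [measurable]: "B \<in> sets M" by (simp add: B_def)
  have um: "cone x0 R \<in> borel_measurable M" unfolding cone_def by measurable
  obtain S where S: "\<And>x. (\<integral>\<^sup>+y. truncated_kernel R \<theta> p x y \<partial>M) \<le> ennreal S"
    using truncated_kernel_integral_bounded[OF assms] by blast
  have "(\<integral>\<^sup>+x. ennreal (\<bar>cone x0 R x\<bar> powr p) \<partial>M) \<le> (\<integral>\<^sup>+x. ennreal (R powr p) * indicator B x \<partial>M)"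
    using assms by (intro nn_integral_mono) (auto simp: cone_def B_def indicator_def intro!: ennreal_leI powr_mono2)
  also have "\<dots> < \<infinity>"
    by (simp add: nn_integral_cmult_indicator B_def emeasure_ball ennreal_mult_less_top)
  finally have Lp: "cone x0 R \<in> Lp_functions M p" using um by (simp add: Lp_functions_def)
  have "besov_energy M \<theta> p (cone x0 R)
    \<le> (\<integral>\<^sup>+x. \<integral>\<^sup>+y. truncated_kernel R \<theta> p x y * indicator B x + ennreal D * (truncated_kernel R \<theta> p y x * indicator B y) \<partial>M \<partial>M)"
    unfolding besov_energy_eq
  proof (intro nn_integral_mono)
    fix x y
    show "besov_integrand \<theta> p (cone x0 R) x y
      \<le> truncated_kernel R \<theta> p x y * indicator B x + ennreal D * (truncated_kernel R \<theta> p y x * indicator B y)"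
    proof (cases "x \<in> B \<or> y \<in> B")
      case True
      have "\<bar>cone x0 R y - cone x0 R x\<bar> \<le> min (dist x y) R"
        using dist_triangle[of x0 x y] dist_triangle[of x0 y x] dist_commute[of x y] assms(1)
        unfolding cone_def by (smt (verit) zero_le_dist)
      then have "\<bar>cone x0 R y - cone x0 R x\<bar> powr p \<le> (min (dist x y) R) powr p"
        using assms by (intro powr_mono2) auto
      then have "besov_integrand \<theta> p (cone x0 R) x y \<le> truncated_kernel R \<theta> p x y"
        by (auto simp: besov_integrand_def truncated_kernel_def intro!: ennreal_leI divide_right_mono)
      moreover note truncated_kernel_swap[of R \<theta> p x y]
      ultimately show ?thesis using True by (auto simp: indicator_def intro: add_increasing add_increasing2)
    qed (auto simp: besov_integrand_def cone_def B_def assms)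
  qed
  also have "\<dots> = (\<integral>\<^sup>+x. (\<integral>\<^sup>+y. truncated_kernel R \<theta> p x y * indicator B x \<partial>M) + (\<integral>\<^sup>+y. ennreal D * (truncated_kernel R \<theta> p y x * indicator B y) \<partial>M) \<partial>M)"
    by (intro nn_integral_cong nn_integral_add) measurable
  also have "\<dots> = (\<integral>\<^sup>+x. \<integral>\<^sup>+y. truncated_kernel R \<theta> p x y * indicator B x \<partial>M \<partial>M) + (\<integral>\<^sup>+x. \<integral>\<^sup>+y. ennreal D * (truncated_kernel R \<theta> p y x * indicator B y) \<partial>M \<partial>M)"
    by (intro nn_integral_add) measurable
  \<comment> \<open>Fubini makes the point confined to \<open>B\<close> the outer variable; after
    renaming, the first summand reappears with the factor \<open>D\<close>.\<close>
  also have "(\<integral>\<^sup>+x. \<integral>\<^sup>+y. ennreal D * (truncated_kernel R \<theta> p y x * indicator B y) \<partial>M \<partial>M)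
    = (\<integral>\<^sup>+y. \<integral>\<^sup>+x. ennreal D * (truncated_kernel R \<theta> p y x * indicator B y) \<partial>M \<partial>M)"
    by (intro pair_sigma_finite.Fubini'[OF pair_sigma_finite_M]) measurable
  also have "\<dots> = ennreal D * (\<integral>\<^sup>+y. \<integral>\<^sup>+x. truncated_kernel R \<theta> p y x * indicator B y \<partial>M \<partial>M)"
    by (simp add: nn_integral_cmult)
  also have "(\<integral>\<^sup>+x. \<integral>\<^sup>+y. truncated_kernel R \<theta> p x y * indicator B x \<partial>M \<partial>M) + \<dots> < \<infinity>"
  proof -
    have "(\<integral>\<^sup>+x. \<integral>\<^sup>+y. truncated_kernel R \<theta> p x y * indicator B x \<partial>M \<partial>M) \<le> (\<integral>\<^sup>+x. ennreal S * indicator B x \<partial>M)"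
      using S by (intro nn_integral_mono) (auto simp: indicator_def)
    also have "\<dots> < \<infinity>"
      by (simp add: nn_integral_cmult_indicator B_def emeasure_ball ennreal_mult_less_top)
    finally show ?thesis by (simp add: ennreal_mult_less_top)
  qed
  finally show ?thesis using Lp by (simp add: besov_space_def)
qed

text \<open>Every ball has positive measure, so an almost everywhere constant value would be
  attained both in \<open>ball x0 R\<close>, where the cone is positive, and in
  \<open>ball x1 R\<close>, where it is 0.\<close>

lemma cone_not_ae_constant:
  assumes "0 < R" "2 * R \<le> dist x0 x1"
  shows "\<not> ae_constant M (cone x0 R)"
proof
  assume "ae_constant M (cone x0 R)"
  then obtain c where c: "AE x in M. cone x0 R x = c" by (auto simp: ae_constant_def)
  have hit: "\<exists>y\<in>ball x R. cone x0 R y = c" for x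
  proof (rule ccontr)
    assume no: "\<not> ?thesis"
    from c have "AE y in M. y \<notin> ball x R" by eventually_elim (use no in auto)
    then have "emeasure M (ball x R) = 0"
      using AE_iff_measurable[of "ball x R" M "\<lambda>y. y \<notin> ball x R"] by (simp del: mem_ball)
    then show False using emeasure_ball_pos[OF assms(1), of x] by simp
  qed
  obtain y where y: "y \<in> ball x0 R" "cone x0 R y = c" using hit by blast
  obtain z where z: "z \<in> ball x1 R" "cone x0 R z = c" using hit by blast
  have "R \<le> dist x0 z" using z assms dist_triangle[of x0 x1 z] by (simp add: dist_commute)
  then show False using y z by (simp add: cone_def)
qed

end

section \<open>Dimension and critical exponent\<close>

text \<open>If \<open>u\<close> and \<open>v\<close> equal \<open>a\<close> and \<open>b\<close>
  almost everywhere, then \<open>b * u - a * v\<close> vanishes almost everywhere. Independence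
  forces \<open>b = 0\<close>, and then \<open>v\<close> alone is already dependent.\<close>

lemma ae_dim_le_1:
  assumes "\<And>u. u \<in> V \<Longrightarrow> ae_constant M u"
  shows "ae_dim M V \<le> 1"
  unfolding ae_dim_def
proof (rule Sup_least, clarify)
  fix S assume S: "finite S" "S \<subseteq> V" "ae_independent M S"
  have ind: "\<forall>u\<in>S. c u = 0" if "AE x in M. (\<Sum>u\<in>S. c u * u x) = 0" for c
    using S(3) that unfolding ae_independent_def by blast
  have "card S \<le> 1"
  proof (rule ccontr)
    assume "\<not> card S \<le> 1"
    then obtain u v where uv: "u \<in> S" "v \<in> S" "u \<noteq> v"
      using S(1) by (metis One_nat_def card_le_Suc0_iff_eq)
    obtain a b where ab: "AE x in M. u x = a" "AE x in M. v x = b"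
      using assms S(2) uv unfolding ae_constant_def by blast
    have two: "(\<Sum>w\<in>S. ((if w = u then s else 0) + (if w = v then t else 0)) * w x) = s * u x + t * v x"
      for s t :: real and x
      using S(1) uv by (simp add: distrib_right sum.distrib if_distrib[of "\<lambda>r. r * _"] sum.delta cong: if_cong)
    have "AE x in M. (\<Sum>w\<in>S. ((if w = u then b else 0) + (if w = v then - a else 0)) * w x) = 0"
      unfolding two using ab by eventually_elim simp
    from ind[OF this] have "b = 0" using uv by auto
    have "AE x in M. (\<Sum>w\<in>S. ((if w = u then 0 else 0) + (if w = v then 1 else 0)) * w x) = 0"
      unfolding two using ab(2) by eventually_elim (simp add: \<open>b = 0\<close>)
    from ind[OF this] show False using uv by auto
  qed
  then show "enat (card S) \<le> 1" by (simp add: one_enat_def)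
qed

lemma doubling_spaceI:
  assumes b: "borel_finite_balls M" and d: "doubling_measure M"
  obtains D where "doubling_space M D"
proof -
  obtain C :: real where C: "\<And>x r. 0 < r \<Longrightarrow> emeasure M (ball x (2 * r)) \<le> ennreal C * emeasure M (ball x r)"
    using d unfolding doubling_measure_def by blast
  have fin: "emeasure M (ball x r) < \<infinity>" "0 < emeasure M (ball x r)" if "0 < r" for x r
    using b that unfolding borel_finite_balls_def by auto
  have eq: "emeasure M (ball x r) = ennreal (measure M (ball x r))" if "0 < r" for x r
    using fin[OF that, of x] by (simp add: emeasure_eq_ennreal_measure)
  \<comment> \<open>\<open>ennreal\<close> sends a negative \<open>C\<close> to 0, so
    \<open>max 0 C\<close> is the real constant that it represents.\<close>
  have "doubling_space M (max 0 C)"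
  proof
    fix x and r :: real assume r: "0 < r"
    have "ennreal (measure M (ball x (2 * r))) \<le> ennreal (max 0 C) * ennreal (measure M (ball x r))"
      using C[OF r, of x] eq[of r x] eq[of "2 * r" x] r
      by (cases "0 \<le> C") (simp_all add: max_def ennreal_neg)
    then show "measure M (ball x (2 * r)) \<le> max 0 C * measure M (ball x r)"
      by (simp flip: ennreal_mult)
  qed (use b in \<open>auto simp: borel_finite_balls_def\<close>)
  then show thesis by (rule that)
qed


theorem corollary1p8:
  fixes M :: "'a::{metric_space, second_countable_topology} measure"
    and p :: real
  assumes "infinite (UNIV :: 'a set)"
    and "borel_finite_balls M"
    and "doubling_measure M"
    and "1 < p"
    and "poincare_inequality M p"
  shows "besov_critical M p = 1 \<and> ae_dim M (besov_space M 1 p) \<le> 1"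
proof
  obtain D where "doubling_space M D"
    using doubling_spaceI[OF assms(2,3)] .
  then interpret doubling_space M D .
  have const: "ae_constant M u" if "1 \<le> \<theta>" "u \<in> besov_space M \<theta> p" for \<theta> u
    using besov_ae_constant[OF assms(4) that assms(5)] .
  show "ae_dim M (besov_space M 1 p) \<le> 1"
    using const by (intro ae_dim_le_1) auto
  define T where "T = {\<theta>. 0 < \<theta> \<and> (\<exists>u \<in> besov_space M \<theta> p. \<not> ae_constant M u)}"
  obtain x0 x1 :: 'a where "x0 \<noteq> x1"
    using assms(1) by (metis (full_types) finite.simps finite_subset insertCI subsetI)
  \<comment> \<open>Half the distance of two distinct points is the largest radius that
    \<open>cone_not_ae_constant\<close> admits.\<close>
  then have nonconst: "\<theta> \<in> T" if "0 < \<theta>" "\<theta> < 1" for \<theta>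
    using cone_in_besov_space[of "dist x0 x1 / 2" \<theta> p x0] cone_not_ae_constant[of "dist x0 x1 / 2" x0 x1]
      that assms(4) unfolding T_def by auto
  have "Sup (ereal ` T) = 1"
  proof (rule antisym)
    show "Sup (ereal ` T) \<le> 1"
    proof -
      have "\<theta> \<le> 1" if "\<theta> \<in> T" for \<theta>
        using const[of \<theta>] that unfolding T_def by force
      then show ?thesis by (intro Sup_least) (auto simp: one_ereal_def)
    qed
    show "1 \<le> Sup (ereal ` T)"
    proof (rule dense_le)
      fix z :: ereal assume "z < 1"
      \<comment> \<open>The maximum with 0 ensures \<open>0 < \<theta>\<close>, since
        \<open>z\<close> may be negative.\<close>
      then obtain \<theta> where \<theta>: "max z 0 < ereal \<theta>" "ereal \<theta> < 1"
        using ereal_dense2[of "max z 0" 1] by auto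
      then have "\<theta> \<in> T" by (intro nonconst) auto
      then have "ereal \<theta> \<le> Sup (ereal ` T)" by (intro Sup_upper) auto
      then show "z \<le> Sup (ereal ` T)" using \<theta> by (meson less_imp_le max.strict_boundedE order_trans)
    qed
  qed
  then show "besov_critical M p = 1" by (simp add: besov_critical_def T_def)
qed

end
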